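(* Let $N\ge1$ be an integer, $a\in\mathbb{R}$, and let $P_n$, $P_n^*$, $g_N$ be as in the context. Let $\xi_1<\xi_2\le\xi_3<\xi_4\le\cdots\le\xi_{2N-1}<\xi_{2N}$ be the roots (counting multiplicity) of $g_N^2(x)=1$ and let $y_1<\cdots<y_{N-1}$ be the zeros of $P_{N-1}(x)$. Then the polynomials $P_n(x)$, $n\ge0$, are orthogonal with respect to the measure $$d\mu(x)=w(x)\,dx+\sum_{k=1}^{N-1}m_k\,d\delta_{y_k}(x),$$ where $$w(x)=\frac{2\sqrt{|1-g_N^2(x)|}}{\pi|P_{N-1}(x)|}$$ is positive and integrable on the intervals $\bigcup_{k=1}^N(\xi_{2k-1},\xi_{2k})$ (the absolutely continuous part $w(x)\,dx$ being supported on these intervals), $d\delta_{y_k}$ is the Dirac delta measure at $y_k$, and $$m_k=\begin{cases}0,&|P_N(y_k)|\ge1,\\[2pt] \dfrac{4\sqrt{|g_N^2(y_k)-1|}}{|P_{N-1}'(y_k)|},&|P_N(y_k)|<1.\end{cases}$$ If $\xi_{2k}=\xi_{2k+1}$ for some $k\in\{1,\ldots,N-1\}$, then $w(x)$ has a removable singularity at $\xi_{2k}$. Moreover, $$\sum_{k=1}^N\int_{\xi_{2k-1}}^{\xi_{2k}}\frac{2\sqrt{|1-g_N^2(x)|}}{\pi|P_{N-1}(x)|}\,dx=1-\sum_{\substack{1\le k\le N-1\\ |P_N(y_k)|<1}}\frac{4\sqrt{|g_N^2(y_k)-1|}}{|P_{N-1}'(y_k)|}.$$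
   Context: Let $q=e^{2\pi i/N}$, so $a(q^n+q^{-n})=2a\cos(2\pi n/N)$. The polynomials $P_n(x)$ are defined by $P_0(x)=1$, $P_1(x)=2x-2a$ and $$2xP_n(x)=P_{n+1}(x)+a(q^n+q^{-n})P_n(x)+P_{n-1}(x),\quad n\ge1.$$ The numerator polynomials $P_n^*(x)$ are defined by the same recurrence for $n\ge 1$ with $P_0^*(x)=0$ and $P_1^*(x)=2$. The polynomial $$g_N(x)=\frac{P_N(x)-P_{N-1}^*(x)/2}{2}$$ has degree $N$; the $2N$ roots of $g_N^2(x)=1$ are all real and can be ordered as in the claim. Orthogonality means $\int_{\mathbb{R}}P_m(x)P_n(x)\,d\mu(x)=0$ for $m\ne n$. *)

theory Defs
  imports "HOL-Analysis.Analysis" "HOL-Probability.Giry_Monad" "HOL-Computational_Algebra.Polynomial"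
begin

definition rec_coeff :: "nat \<Rightarrow> real \<Rightarrow> nat \<Rightarrow> real" where
  "rec_coeff N a n = 2 * a * cos (2 * pi * real n / real N)"

text \<open>With \<open>q = exp (2\<pi>i/N)\<close> the diagonal recurrence coefficient is \<open>a (q\<^sup>n + q\<^sup>-\<^sup>n)\<close>.\<close>

lemma of_real_rec_coeff:
  fixes N :: nat and a :: real
  defines "q \<equiv> exp (2 * of_real pi * \<i> / of_nat N :: complex)"
  shows "complex_of_real (rec_coeff N a n) = of_real a * (q ^ n + inverse q ^ n)"
proof -
  have q: "q = cis (2 * pi / real N)"
    by (simp add: q_def cis_conv_exp mult_ac)
  have 1: "q ^ n = cis (2 * pi * real n / real N)"
    unfolding q by (simp add: Complex.DeMoivre cis_inverse field_simps)
  have 2: "inverse q ^ n = cis (- (2 * pi * real n / real N))"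
    using 1 by (simp add: power_inverse)
  show ?thesis
    unfolding 1 2 by (simp add: rec_coeff_def complex_eq_iff)
qed

fun PN :: "nat \<Rightarrow> real \<Rightarrow> nat \<Rightarrow> real poly" where
  "PN N a 0 = 1"
| "PN N a (Suc 0) = [:- 2 * a, 2:]"
| "PN N a (Suc (Suc n)) = [:- rec_coeff N a (Suc n), 2:] * PN N a (Suc n) - PN N a n"

fun PN_star :: "nat \<Rightarrow> real \<Rightarrow> nat \<Rightarrow> real poly" where
  "PN_star N a 0 = 0"
| "PN_star N a (Suc 0) = [:2:]"
| "PN_star N a (Suc (Suc n)) =
     [:- rec_coeff N a (Suc n), 2:] * PN_star N a (Suc n) - PN_star N a n"

lemma PN_recurrence:
  assumes "n \<ge> 1"
  shows "2 * x * poly (PN N a n) x =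
    poly (PN N a (n + 1)) x + rec_coeff N a n * poly (PN N a n) x + poly (PN N a (n - 1)) x"
  using assms by (cases n) (simp_all add: algebra_simps)

lemma PN_star_recurrence:
  assumes "n \<ge> 1"
  shows "2 * x * poly (PN_star N a n) x =
    poly (PN_star N a (n + 1)) x + rec_coeff N a n * poly (PN_star N a n) x
      + poly (PN_star N a (n - 1)) x"
  using assms by (cases n) (simp_all add: algebra_simps)

definition gN :: "nat \<Rightarrow> real \<Rightarrow> real poly" where
  "gN N a = smult (1/2) (PN N a N - smult (1/2) (PN_star N a (N - 1)))"

definition weight :: "nat \<Rightarrow> real \<Rightarrow> real \<Rightarrow> real" where
  "weight N a x =
     2 * sqrt \<bar>1 - (poly (gN N a) x)\<^sup>2\<bar> / (pi * \<bar>poly (PN N a (N - 1)) x\<bar>)"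

definition mass :: "nat \<Rightarrow> real \<Rightarrow> real \<Rightarrow> real" where
  "mass N a y =
     (if \<bar>poly (PN N a N) y\<bar> \<ge> 1 then 0
      else 4 * sqrt \<bar>(poly (gN N a) y)\<^sup>2 - 1\<bar> / \<bar>poly (pderiv (PN N a (N - 1))) y\<bar>)"

definition bands :: "nat \<Rightarrow> (nat \<Rightarrow> real) \<Rightarrow> real set" where
  "bands N \<xi> = (\<Union>k\<in>{1..N}. {\<xi> (2 * k - 1) <..< \<xi> (2 * k)})"

definition mu :: "nat \<Rightarrow> real \<Rightarrow> (nat \<Rightarrow> real) \<Rightarrow> (nat \<Rightarrow> real) \<Rightarrow> real measure" where
  "mu N a \<xi> y = measure_of UNIV (sets borel)
     (\<lambda>A. emeasure (density lborel (\<lambda>x. ennreal (indicator (bands N \<xi>) x * weight N a x))) A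
        + (\<Sum>k=1..N - 1. ennreal (mass N a (y k)) * emeasure (return borel (y k)) A))"

lemma space_mu [simp]: "space (mu N a \<xi> y) = UNIV"
  by (simp add: mu_def space_measure_of_conv)

lemma sets_mu [simp, measurable_cong]: "sets (mu N a \<xi> y) = sets borel"
  by (simp add: mu_def sets_measure_of_conv) (metis sets.sigma_sets_eq space_borel)

text \<open>The set function in \<open>mu_def\<close> is countably additive, so \<open>measure_of\<close> does not
  degenerate to the null measure.\<close>

lemma emeasure_mu:
  assumes "A \<in> sets borel"
  shows "emeasure (mu N a \<xi> y) A =
    emeasure (density lborel (\<lambda>x. ennreal (indicator (bands N \<xi>) x * weight N a x))) A
      + (\<Sum>k=1..N - 1. ennreal (mass N a (y k)) * emeasure (return borel (y k)) A)"
proof (rule emeasure_measure_of[OF mu_def])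
  let ?D = "density lborel (\<lambda>x. ennreal (indicator (bands N \<xi>) x * weight N a x))"
  show "countably_additive (sets (mu N a \<xi> y)) (\<lambda>A. emeasure ?D A
      + (\<Sum>k=1..N - 1. ennreal (mass N a (y k)) * emeasure (return borel (y k)) A))"
  proof (rule countably_additiveI)
    fix F :: "nat \<Rightarrow> real set"
    assume F: "range F \<subseteq> sets (mu N a \<xi> y)" "disjoint_family F"
    have 1: "(\<Sum>i. emeasure ?D (F i)) = emeasure ?D (\<Union>i. F i)"
      using F by (intro suminf_emeasure) auto
    have 2: "(\<Sum>i. emeasure (return borel (y k)) (F i)) = emeasure (return borel (y k)) (\<Union>i. F i)" for k
      using F by (intro suminf_emeasure) auto
    have "(\<Sum>i. emeasure ?D (F i)
        + (\<Sum>k=1..N - 1. ennreal (mass N a (y k)) * emeasure (return borel (y k)) (F i)))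
      = (\<Sum>i. emeasure ?D (F i))
        + (\<Sum>i. \<Sum>k=1..N - 1. ennreal (mass N a (y k)) * emeasure (return borel (y k)) (F i))"
      by (intro suminf_add[symmetric]) auto
    also have "(\<Sum>i. \<Sum>k=1..N - 1. ennreal (mass N a (y k)) * emeasure (return borel (y k)) (F i))
      = (\<Sum>k=1..N - 1. ennreal (mass N a (y k)) * emeasure (return borel (y k)) (\<Union>i. F i))"
      by (subst suminf_sum) (auto simp: 2)
    finally show "(\<Sum>i. emeasure ?D (F i)
        + (\<Sum>k=1..N - 1. ennreal (mass N a (y k)) * emeasure (return borel (y k)) (F i)))
      = emeasure ?D (\<Union>i. F i)
        + (\<Sum>k=1..N - 1. ennreal (mass N a (y k)) * emeasure (return borel (y k)) (\<Union>i. F i))"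
      by (simp add: 1)
  qed
qed (use assms in \<open>auto simp: positive_def\<close>)

text \<open>Integrability is required explicitly because the Bochner integral of a non-integrable
  function is \<open>0\<close> by convention.\<close>

definition orthogonal_wrt :: "real measure \<Rightarrow> (nat \<Rightarrow> real poly) \<Rightarrow> bool" where
  "orthogonal_wrt M p \<longleftrightarrow>
     (\<forall>m n. integrable M (\<lambda>x. poly (p m) x * poly (p n) x)) \<and>
     (\<forall>m n. m \<noteq> n \<longrightarrow> (\<integral>x. poly (p m) x * poly (p n) x \<partial>M) = 0)"

end

theory Submission
  imports Defs
begin

text \<open>
  Write \<open>p = P\<^sub>N\<^sub>-\<^sub>1\<close>, \<open>g = g\<^sub>N\<close> and \<open>\<lambda>\<^sub>k = P\<^sub>N (y\<^sub>k)\<close>. The recurrence is \<open>N\<close>-periodic, its monodromy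
  matrix has trace \<open>2 g\<close>, and \<open>\<lambda>\<^sub>k\<close>, \<open>1/\<lambda>\<^sub>k\<close> are its eigenvalues at \<open>y\<^sub>k\<close>, so
  \<open>g (y\<^sub>k) = (\<lambda>\<^sub>k + 1/\<lambda>\<^sub>k)/2\<close>. By Christoffel--Darboux \<open>\<lambda>\<^sub>k p'(y\<^sub>k) < 0\<close>, hence \<open>g\<close> is alternately
  \<open>\<ge> 1\<close> and \<open>\<le> -1\<close> at the \<open>y\<^sub>k\<close>, and for \<open>\<bar>t\<bar> < 1\<close> the equation \<open>g = t\<close> has exactly one
  root between consecutive \<open>y\<^sub>k\<close>. Substituting \<open>g x = cos \<theta>\<close> on each branch and summing the residues of
  \<open>f / (p (g - t))\<close> turns \<open>\<integral> f U\<^sub>m(g) w\<close>, for \<open>deg f \<le> 2N - 2\<close> and Chebyshev polynomials \<open>U\<^sub>m\<close>,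
  into the elementary integrals of \<open>sin\<^sup>2 \<theta> U\<^sub>m(cos \<theta>) / (g (y\<^sub>k) - cos \<theta>)\<close>; adding the point masses
  leaves a rational function of the \<open>\<lambda>\<^sub>k\<close>. Since \<open>P\<^sub>j\<^sub>N\<^sub>+\<^sub>r = U\<^sub>j\<^sub>-\<^sub>1(g) P\<^sub>N\<^sub>+\<^sub>r - U\<^sub>j\<^sub>-\<^sub>2(g) P\<^sub>r\<close>, this
  evaluates \<open>\<integral> P\<^sub>n d\<mu> = \<delta>\<^sub>n\<^sub>0\<close>, and the recurrence propagates it to \<open>\<integral> P\<^sub>m P\<^sub>n d\<mu> = \<delta>\<^sub>m\<^sub>n\<close>.
\<close>

section \<open>The periodic recurrence\<close>

text \<open>Half of the numerator polynomials: the solution of the recurrence with initial values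
  \<open>0\<close>, \<open>1\<close>, normalised so that its Casorati determinant with
  \<open>PN\<close> is \<open>1\<close>.\<close>

definition QN :: "nat \<Rightarrow> real \<Rightarrow> nat \<Rightarrow> real poly" where
  "QN N a n = smult (1/2) (PN_star N a n)"

lemma QN_0 [simp]: "QN N a 0 = 0"
  and QN_1 [simp]: "QN N a (Suc 0) = 1"
  and QN_rec: "QN N a (Suc (Suc n)) = [:- rec_coeff N a (Suc n), 2:] * QN N a (Suc n) - QN N a n"
  by (simp_all add: QN_def smult_diff_right)

lemma two_gN: "smult 2 (gN N a) = PN N a N - QN N a (N - 1)"
  by (simp add: gN_def QN_def smult_diff_right)

lemma rec_coeff_periodic:
  assumes "N \<ge> 1"
  shows "rec_coeff N a (n + N) = rec_coeff N a n"
proof -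
  have "2 * pi * real (n + N) / real N = 2 * pi * real n / real N + 2 * pi"
    using assms by (simp add: field_simps)
  thus ?thesis by (simp add: rec_coeff_def)
qed

lemma rec_coeff_0: "rec_coeff N a 0 = 2 * a"
  by (simp add: rec_coeff_def)

text \<open>One step of the recurrence has determinant \<open>1\<close>, so this Casorati
  determinant does not depend on \<open>n\<close>.\<close>

lemma wronskian: "PN N a n * QN N a (Suc n) - PN N a (Suc n) * QN N a n = 1"
proof (induction n)
  case (Suc n)
  have "PN N a (Suc n) * QN N a (Suc (Suc n)) - PN N a (Suc (Suc n)) * QN N a (Suc n)
      = PN N a n * QN N a (Suc n) - PN N a (Suc n) * QN N a n"
    by (simp add: QN_rec algebra_simps)
  with Suc show ?case by simp
qed simp

text \<open>By periodicity the shifted sequence solves the same recurrence, hence is a combination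
  of the basic solutions \<open>PN\<close> and \<open>QN\<close>; the values at \<open>n = 0\<close>
  and \<open>n = 1\<close> determine the coefficients, which form a row of the monodromy
  matrix.\<close>

lemma PN_shift:
  assumes "N \<ge> 1"
  shows "PN N a (n + N) = PN N a N * PN N a n - PN N a (N - 1) * QN N a n"
proof (induction n rule: induct_nat_012)
  case 1
  obtain M where M: "N = Suc M" using assms by (cases N) auto
  \<comment> \<open>\<open>P_1 = 2x - 2a\<close> is itself a recurrence step, with coefficient
    \<open>b_0 = 2a\<close> and \<open>P_{-1} = 0\<close>; so periodicity reaches down to index
    \<open>0\<close>.\<close>
  have "rec_coeff N a N = 2 * a"
    using rec_coeff_periodic[OF assms, of a 0] by (simp add: rec_coeff_0)
  thus ?case by (simp add: M)
next
  case (ge2 n)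
  have "PN N a (Suc (Suc n) + N)
      = [:- rec_coeff N a (Suc n), 2:] * PN N a (Suc n + N) - PN N a (n + N)"
    using rec_coeff_periodic[OF assms, of a "Suc n"] by simp
  also have "\<dots> = PN N a N * PN N a (Suc (Suc n)) - PN N a (N - 1) * QN N a (Suc (Suc n))"
    unfolding ge2 QN_rec by (simp add: algebra_simps)
  finally show ?case .
qed simp

lemma QN_shift:
  assumes "N \<ge> 1"
  shows "QN N a (n + N) = QN N a N * PN N a n - QN N a (N - 1) * QN N a n"
proof (induction n rule: induct_nat_012)
  case 1
  obtain M where M: "N = Suc M" using assms by (cases N) auto
  have "rec_coeff N a N = 2 * a"
    using rec_coeff_periodic[OF assms, of a 0] by (simp add: rec_coeff_0)
  thus ?case by (simp add: M QN_rec)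
next
  case (ge2 n)
  have "QN N a (Suc (Suc n) + N)
      = [:- rec_coeff N a (Suc n), 2:] * QN N a (Suc n + N) - QN N a (n + N)"
    using rec_coeff_periodic[OF assms, of a "Suc n"] by (simp add: QN_rec)
  also have "\<dots> = QN N a N * PN N a (Suc (Suc n)) - QN N a (N - 1) * QN N a (Suc (Suc n))"
    unfolding ge2 QN_rec by (simp add: algebra_simps)
  finally show ?case .
qed simp

text \<open>Cayley--Hamilton for the monodromy matrix, whose determinant is \<open>1\<close> and whose trace is
  \<open>2 g\<^sub>N\<close>.\<close>

lemma PN_shift2:
  assumes "N \<ge> 1"
  shows "PN N a (n + 2 * N) = smult 2 (gN N a) * PN N a (n + N) - PN N a n"
proof -
  let ?P = "PN N a" and ?Q = "QN N a"
  have w: "?P (N - 1) * ?Q N = 1 + ?P N * ?Q (N - 1)"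
    using wronskian[of N a "N - 1"] assms by (simp add: algebra_simps)
  have "?P (n + 2 * N) = ?P N * ?P (n + N) - ?P (N - 1) * ?Q (n + N)"
    using PN_shift[OF assms, of a "n + N"] by (simp add: mult_2 add_ac)
  also have "\<dots> = ?P N * ?P (n + N) - (?P (N - 1) * ?Q N) * ?P n + ?P (N - 1) * ?Q (N - 1) * ?Q n"
    unfolding QN_shift[OF assms, of a n] by (simp add: algebra_simps)
  also have "\<dots> = ?P N * ?P (n + N) - ?P n - ?Q (N - 1) * (?P N * ?P n - ?P (N - 1) * ?Q n)"
    unfolding w by (simp add: algebra_simps)
  also have "\<dots> = smult 2 (gN N a) * ?P (n + N) - ?P n"
    unfolding two_gN PN_shift[OF assms, of a n, symmetric] by (simp add: algebra_simps)
  finally show ?thesis .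
qed

text \<open>For \<open>n = N - 1\<close> both terms of the shift formula contain
  \<open>P_{N-1}\<close>, and the cofactor is the trace.\<close>

lemma PN_2N_minus_1:
  assumes "N \<ge> 1"
  shows "PN N a (N - 1 + N) = smult 2 (gN N a) * PN N a (N - 1)"
  unfolding PN_shift[OF assms] two_gN by (simp add: algebra_simps)

section \<open>Degrees and leading coefficients\<close>

lemma degree_PN: "degree (PN N a n) = n \<and> coeff (PN N a n) n = 2 ^ n"
proof (induction n rule: induct_nat_012)
  case (ge2 n)
  let ?L = "[:- rec_coeff N a (Suc n), 2:]"
  have nz: "PN N a (Suc n) \<noteq> 0" using ge2 by auto
  have d: "degree (?L * PN N a (Suc n)) = Suc (Suc n)"
    using ge2 nz by (subst degree_mult_eq) auto
  have l: "lead_coeff (?L * PN N a (Suc n)) = 2 ^ Suc (Suc n)"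
    using ge2 unfolding lead_coeff_mult by simp
  have "degree (PN N a (Suc (Suc n))) = Suc (Suc n)"
    using d ge2 unfolding PN.simps diff_conv_add_uminus by (subst degree_add_eq_left) auto
  moreover have "coeff (PN N a n) (Suc (Suc n)) = 0"
    using ge2 by (intro coeff_eq_0) auto
  ultimately show ?case using l d by (simp del: mult_pCons_left)
qed (simp_all)

lemma degree_PN_eq [simp]: "degree (PN N a n) = n"
  and coeff_PN_self [simp]: "coeff (PN N a n) n = 2 ^ n"
  using degree_PN[of N a n] by simp_all

lemma degree_QN: "degree (QN N a (Suc n)) = n \<and> coeff (QN N a (Suc n)) n = 2 ^ n"
proof (induction n rule: induct_nat_012)
  case (ge2 n)
  let ?L = "[:- rec_coeff N a (Suc (Suc n)), 2:]"
  have nz: "QN N a (Suc (Suc n)) \<noteq> 0" using ge2 by auto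
  have d: "degree (?L * QN N a (Suc (Suc n))) = Suc (Suc n)"
    using ge2 nz by (subst degree_mult_eq) auto
  have l: "lead_coeff (?L * QN N a (Suc (Suc n))) = 2 ^ Suc (Suc n)"
    using ge2 unfolding lead_coeff_mult by simp
  have "degree (QN N a (Suc (Suc (Suc n)))) = Suc (Suc n)"
    using d ge2 unfolding QN_rec[of _ _ "Suc n"] diff_conv_add_uminus
    by (subst degree_add_eq_left) auto
  moreover have "coeff (QN N a (Suc n)) (Suc (Suc n)) = 0"
    using ge2 by (intro coeff_eq_0) auto
  ultimately show ?case using l d unfolding QN_rec[of _ _ "Suc n"]
    by (simp del: mult_pCons_left)
qed (simp_all add: QN_rec)

lemma degree_gN:
  assumes "N \<ge> 1"
  shows "degree (gN N a) = N" and "lead_coeff (gN N a) = 2 ^ (N - 1)"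
proof -
  have q: "degree (QN N a (N - 1)) < N"
    using degree_QN[of N a "N - 2"] assms
    by (cases "N = 1") (auto simp: numeral_2_eq_2 Suc_diff_Suc)
  have d2: "degree (smult 2 (gN N a)) = N"
    using q unfolding two_gN diff_conv_add_uminus by (subst degree_add_eq_left) auto
  have "coeff (smult 2 (gN N a)) N = 2 ^ N"
    using q unfolding two_gN by (simp add: coeff_eq_0)
  moreover show d: "degree (gN N a) = N" using d2 by simp
  ultimately show "lead_coeff (gN N a) = 2 ^ (N - 1)"
    using assms by (cases N) auto
qed

text \<open>As a sequence in \<open>k\<close> this is an associated polynomial: it starts from
  \<open>1\<close> and satisfies the recurrence with shifted coefficients. It later bounds the
  degree of a polynomial that replaces \<open>P_r / P_N\<close> at the zeros of
  \<open>P_{N-1}\<close>.\<close>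

lemma degree_casorati_le: "degree (PN N a r * QN N a (r + 1 + k) - PN N a (r + 1 + k) * QN N a r) \<le> k"
proof (induction k rule: induct_nat_012)
  case 0
  show ?case using wronskian[of N a r] by simp
next
  case 1
  have "PN N a r * QN N a (r + 1 + 1) - PN N a (r + 1 + 1) * QN N a r
     = [:- rec_coeff N a (Suc r), 2:] * (PN N a r * QN N a (Suc r) - PN N a (Suc r) * QN N a r)"
    by (simp add: QN_rec algebra_simps)
  thus ?case unfolding wronskian by simp
next
  case (ge2 k)
  let ?R = "\<lambda>k. PN N a r * QN N a (r + 1 + k) - PN N a (r + 1 + k) * QN N a r"
  have "?R (Suc (Suc k)) = [:- rec_coeff N a (r + 1 + Suc k), 2:] * ?R (Suc k) - ?R k"
    by (simp add: QN_rec algebra_simps del: mult_pCons_left mult_pCons_right)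
  moreover have "degree ([:- rec_coeff N a (r + 1 + Suc k), 2:] * ?R (Suc k)) \<le> Suc (Suc k)"
    using ge2(2) by (intro order.trans[OF degree_mult_le]) simp
  ultimately show ?case using ge2(1) by (metis degree_diff_le le_Suc_eq)
qed

text \<open>Confluent Christoffel-Darboux formula: each step adds \<open>2 P_{n+1}^2\<close>, so the
  expression is twice a sum of squares that includes \<open>P_0^2 = 1\<close>.\<close>

lemma christoffel_darboux_pos:
  "poly (pderiv (PN N a (Suc n))) x * poly (PN N a n) x
     - poly (PN N a (Suc n)) x * poly (pderiv (PN N a n)) x > 0"
proof (induction n)
  case (Suc n)
  have "poly (pderiv (PN N a (Suc (Suc n)))) x * poly (PN N a (Suc n)) x
     - poly (PN N a (Suc (Suc n))) x * poly (pderiv (PN N a (Suc n))) x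
    = 2 * (poly (PN N a (Suc n)) x)\<^sup>2 + (poly (pderiv (PN N a (Suc n))) x * poly (PN N a n) x
     - poly (PN N a (Suc n)) x * poly (pderiv (PN N a n)) x)"
    by (simp add: pderiv_mult pderiv_diff pderiv_pCons algebra_simps power2_eq_square
        del: mult_pCons_left mult_pCons_right)
  thus ?case using Suc by (simp add: add_nonneg_pos)
qed (simp add: pderiv_pCons)

text \<open>At a zero of \<open>P_{N-1}\<close> the monodromy matrix is triangular with diagonal
  entries \<open>P_N\<close> and \<open>-Q_{N-1}\<close>; determinant \<open>1\<close> makes them
  reciprocal, and the trace gives \<open>g\<close>.\<close>

lemma at_zero_of_PN:
  assumes "N \<ge> 1" and y: "poly (PN N a (N - 1)) y = 0"
  defines "l \<equiv> poly (PN N a N) y"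
  shows "l \<noteq> 0" "poly (QN N a (N - 1)) y = - inverse l"
    "poly (gN N a) y = (l + inverse l) / 2"
    "l * poly (pderiv (PN N a (N - 1))) y < 0"
    "poly (PN N a (n + N)) y = l * poly (PN N a n) y"
proof -
  have w: "poly (PN N a (N - 1) * QN N a N - PN N a N * QN N a (N - 1)) y = 1"
    using wronskian[of N a "N - 1"] assms by simp
  hence lq: "l * poly (QN N a (N - 1)) y = -1" using y by (simp add: l_def)
  show l0: "l \<noteq> 0" using lq by auto
  show q: "poly (QN N a (N - 1)) y = - inverse l" using lq l0 by (simp add: field_simps)
  have "poly (smult 2 (gN N a)) y = l + inverse l" unfolding two_gN using q by (simp add: l_def)
  thus "poly (gN N a) y = (l + inverse l) / 2" by simp
  show "l * poly (pderiv (PN N a (N - 1))) y < 0"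
    using christoffel_darboux_pos[of N a "N - 1" y] y assms(1) by (simp add: l_def)
  show "poly (PN N a (n + N)) y = l * poly (PN N a n) y"
    using y unfolding PN_shift[OF assms(1)] by (simp add: l_def)
qed

section \<open>Interlacing polynomials\<close>

lemma degree_prod_linear:
  fixes R :: "real set"
  shows "degree (\<Prod>r\<in>R. [:-r, 1:]) = card R"
  by (subst degree_prod_eq_sum_degree) auto

lemma coeff_prod_linear:
  fixes R :: "real set"
  shows "coeff (\<Prod>r\<in>R. [:-r, 1:]) (card R) = 1"
  using lead_coeff_prod[of "\<lambda>r. [:-r, 1:]" R] by (simp add: degree_prod_linear)

lemma poly_eq_prod_linear:
  fixes q :: "real poly"
  assumes "finite R" "degree q = card R" "\<And>r. r \<in> R \<Longrightarrow> poly q r = 0"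
  shows "q = smult (lead_coeff q) (\<Prod>r\<in>R. [:-r, 1:])"
proof (rule poly_eqI_degree_lead_coeff[where n = "card R" and A = R])
  show "poly q r = poly (smult (lead_coeff q) (\<Prod>r\<in>R. [:-r, 1:])) r" if "r \<in> R" for r
    using that assms by (auto simp: poly_prod intro!: prod_zero bexI[of _ r])
qed (use assms in \<open>auto simp: coeff_prod_linear degree_prod_linear\<close>)

lemma pderiv_prod_linear_at_root:
  fixes R :: "real set"
  assumes "finite R" "r \<in> R"
  shows "poly (pderiv (\<Prod>r\<in>R. [:-r, 1:])) r = (\<Prod>s\<in>R - {r}. r - s)"
proof -
  have "poly (pderiv (\<Prod>r\<in>R. [:-r, 1:])) r = (\<Sum>s\<in>R. \<Prod>u\<in>R - {s}. r - u)"
    by (simp add: pderiv_prod poly_sum poly_prod pderiv_pCons)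
  also have "\<dots> = (\<Sum>s\<in>R. if s = r then (\<Prod>u\<in>R - {r}. r - u) else 0)"
    using assms by (intro sum.cong refl) (auto intro!: prod_zero bexI[of _ r])
  also have "\<dots> = (\<Prod>s\<in>R - {r}. r - s)"
    using assms by simp
  finally show ?thesis .
qed

text \<open>Compare the top coefficients in Lagrange's interpolation formula for \<open>f\<close>.\<close>

lemma sum_over_simple_roots:
  fixes f q :: "real poly"
  assumes R: "finite R" "degree q = card R" "\<And>r. r \<in> R \<Longrightarrow> poly q r = 0"
    and f: "degree f < card R"
  shows "(\<Sum>r\<in>R. poly f r / poly (pderiv q) r) = coeff f (card R - 1) / lead_coeff q"
proof -
  let ?L = "\<lambda>r. \<Prod>s\<in>R - {r}. [:-s, 1:]"
  let ?d = "\<lambda>r. \<Prod>s\<in>R - {r}. r - s"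
  define h where "h = (\<Sum>r\<in>R. smult (poly f r / ?d r) (?L r))"
  have d0: "?d r \<noteq> 0" if "r \<in> R" for r
    using R(1) by simp
  have "f = h"
  proof (rule poly_eqI_degree[where A = R])
    fix u assume u: "u \<in> R"
    have "poly h u = (\<Sum>r\<in>R. poly f r / ?d r * (\<Prod>s\<in>R - {r}. u - s))"
      by (simp add: h_def poly_sum poly_prod)
    also have "\<dots> = (\<Sum>r\<in>R. if r = u then poly f u else 0)"
      using u R(1) d0 by (intro sum.cong refl) (auto intro!: prod_zero bexI[of _ u])
    also have "\<dots> = poly f u" using u R(1) by simp
    finally show "poly f u = poly h u" ..
  next
    have "degree h \<le> card R - 1"
      unfolding h_def
      by (intro degree_sum_le R(1) order.trans[OF degree_smult_le])
         (use R(1) in \<open>simp add: degree_prod_linear\<close>)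
    thus "degree h < card R" using f by linarith
  qed (use f in auto)
  have "coeff (?L r) (card R - 1) = 1" if "r \<in> R" for r
    using coeff_prod_linear[of "R - {r}"] that R(1) by simp
  hence "coeff f (card R - 1) = (\<Sum>r\<in>R. poly f r / ?d r)"
    by (subst \<open>f = h\<close>) (simp add: h_def coeff_sum)
  moreover have "poly (pderiv q) r = lead_coeff q * ?d r" if "r \<in> R" for r
  proof -
    have "poly (pderiv q) r = poly (pderiv (smult (lead_coeff q) (\<Prod>r\<in>R. [:-r, 1:]))) r"
      using poly_eq_prod_linear[OF R] by simp
    thus ?thesis using that R(1) by (simp add: pderiv_smult pderiv_prod_linear_at_root)
  qed
  ultimately show ?thesis
    by (simp add: sum_divide_distrib mult.commute cong: sum.cong)
qed

text \<open>Only the inner nodes \<open>z 1\<close>, ..., \<open>z (N - 1)\<close> are zeros of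
  \<open>p\<close>; \<open>z 0\<close> and \<open>z N\<close> are auxiliary end points. The
  alternating signs of \<open>g\<close> at all nodes encode the band structure.\<close>

locale interlacing =
  fixes N :: nat and p g :: "real poly" and z :: "nat \<Rightarrow> real"
  assumes N: "N \<ge> 1"
    and z: "strict_mono_on {0..N} z"
    and g_z: "\<And>j. j \<le> N \<Longrightarrow> (-1) ^ (N - j) * poly g (z j) \<ge> 1"
    and deg_g: "degree g = N" and lc_g: "lead_coeff g > 0"
    and deg_p: "degree p = N - 1" and lc_p: "lead_coeff p > 0"
    and p_z: "\<And>j. 1 \<le> j \<Longrightarrow> j < N \<Longrightarrow> poly p (z j) = 0"
begin

section \<open>The roots of \<open>g = t\<close> between the nodes\<close>

lemma z_less: "i < j \<Longrightarrow> j \<le> N \<Longrightarrow> z i < z j"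
  using z by (auto simp: strict_mono_on_def)

lemma z_le: "i \<le> j \<Longrightarrow> j \<le> N \<Longrightarrow> z i \<le> z j"
  using z_less[of i j] by (cases "i = j") auto

lemma root_ex:
  assumes "\<bar>t\<bar> < 1" "j < N"
  shows "\<exists>x. z j < x \<and> x < z (Suc j) \<and> poly g x = t"
proof -
  have e: "N - j = Suc (N - Suc j)" using assms by simp
  have "poly (g - [:t:]) (z j) * poly (g - [:t:]) (z (Suc j)) < 0"
    using g_z[of j] g_z[of "Suc j"] assms unfolding e
    by (cases "even (N - Suc j)") (auto simp: mult_less_0_iff)
  from poly_IVT[OF _ this] z_less[of j "Suc j"] assms show ?thesis by auto
qed

text \<open>The inverse branch of \<open>g\<close> between \<open>z j\<close> and
  \<open>z (Suc j)\<close>; that the choice is unique follows from the degree count in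
  \<open>root_in_interval\<close>.\<close>

definition X :: "real \<Rightarrow> nat \<Rightarrow> real" where
  "X t j = (SOME x. z j < x \<and> x < z (Suc j) \<and> poly g x = t)"

lemma X:
  assumes "\<bar>t\<bar> < 1" "j < N"
  shows "z j < X t j" "X t j < z (Suc j)" "poly g (X t j) = t"
  using someI_ex[OF root_ex[OF assms]] unfolding X_def by auto

lemma X_less:
  assumes "\<bar>t\<bar> < 1" "i < j" "j < N"
  shows "X t i < X t j"
  using X(2)[of t i] X(1)[of t j] z_le[of "Suc i" j] assms by auto

lemma X_inj: "\<bar>t\<bar> < 1 \<Longrightarrow> inj_on (X t) {..<N}"
  by (rule linorder_inj_onI') (use X_less in fastforce)

lemma deg_g_minus: "degree (g - [:t:]) = N" "lead_coeff (g - [:t:]) = lead_coeff g"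
proof -
  show d: "degree (g - [:t:]) = N"
    using N unfolding diff_conv_add_uminus by (subst degree_add_eq_left) (auto simp: deg_g)
  show "lead_coeff (g - [:t:]) = lead_coeff g"
    unfolding d deg_g using N by (simp add: coeff_pCons split: nat.split)
qed

text \<open>The \<open>N\<close> intervals supply \<open>N\<close> distinct roots, which exhaust the
  degree.\<close>

lemma g_minus_eq:
  assumes "\<bar>t\<bar> < 1"
  shows "g - [:t:] = smult (lead_coeff g) (\<Prod>r\<in>X t ` {..<N}. [:-r, 1:])"
proof -
  have "g - [:t:] = smult (lead_coeff (g - [:t:])) (\<Prod>r\<in>X t ` {..<N}. [:-r, 1:])"
    using X(3)[OF assms] X_inj[OF assms]
    by (intro poly_eq_prod_linear) (auto simp: deg_g_minus(1) card_image)
  thus ?thesis unfolding deg_g_minus(2) .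
qed

lemma root_is_X:
  assumes "\<bar>poly g x\<bar> < 1"
  shows "\<exists>j<N. x = X (poly g x) j"
proof -
  have "poly (g - [:poly g x:]) x = 0" by simp
  hence "poly (smult (lead_coeff g) (\<Prod>r\<in>X (poly g x) ` {..<N}. [:-r, 1:])) x = 0"
    by (subst (asm) g_minus_eq[OF assms])
  hence "(\<Prod>r\<in>X (poly g x) ` {..<N}. x - r) = 0" using lc_g by (auto simp: poly_prod)
  thus ?thesis by auto
qed

lemma root_in_interval:
  assumes "\<bar>poly g x\<bar> < 1" "j < N" "z j < x" "x < z (Suc j)"
  shows "x = X (poly g x) j"
proof -
  obtain i where i: "i < N" "x = X (poly g x) i" using root_is_X[OF assms(1)] by auto
  have "z i < x" "x < z (Suc i)" using X[OF assms(1) i(1)] i(2) by auto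
  hence "\<not> i < j" "\<not> j < i"
    using z_le[of "Suc i" j] z_le[of "Suc j" i] assms i(1) by auto
  thus ?thesis using i by simp
qed

lemma z_inj: "inj_on z {1..N - 1}"
  by (rule linorder_inj_onI') (use z_less N in fastforce)

lemma p_eq: "p = smult (lead_coeff p) (\<Prod>r\<in>z ` {1..N - 1}. [:-r, 1:])"
  using z_inj p_z by (intro poly_eq_prod_linear) (auto simp: card_image deg_p)

lemma g_z_abs: "j \<le> N \<Longrightarrow> \<bar>poly g (z j)\<bar> \<ge> 1"
  using g_z[of j] by (cases "even (N - j)") auto

text \<open>Both values are products of \<open>N - 1\<close> differences, over the nodes for
  \<open>p\<close> and over the other roots for \<open>g'\<close>. They can be paired so that the
  two differences in each pair have the same sign.\<close>

lemma p_pderiv_g_pos: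
  assumes t: "\<bar>t\<bar> < 1" and j: "j < N"
  shows "poly p (X t j) * poly (pderiv g) (X t j) > 0"
proof -
  let ?x = "X t j" and ?J = "{..<N} - {j}"
  have "poly (pderiv g) ?x = poly (pderiv (g - [:t:])) ?x" by (simp add: pderiv_diff pderiv_pCons)
  also have "\<dots> = lead_coeff g * (\<Prod>s\<in>X t ` {..<N} - {?x}. ?x - s)"
    unfolding g_minus_eq[OF t] using j by (simp add: pderiv_smult pderiv_prod_linear_at_root)
  also have "X t ` {..<N} - {?x} = X t ` ?J" using X_inj[OF t] j by (auto simp: inj_on_def)
  also have "(\<Prod>s\<in>X t ` ?J. ?x - s) = (\<Prod>i\<in>?J. ?x - X t i)"
    using X_inj[OF t] by (subst prod.reindex) (auto simp: inj_on_def)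
  finally have g': "poly (pderiv g) ?x = lead_coeff g * (\<Prod>i\<in>?J. ?x - X t i)" .
  \<comment> \<open>The root \<open>X t i\<close> is paired with the end point of its own interval
    that faces \<open>X t j\<close>; both then lie on the same side of \<open>X t j\<close>.\<close>
  define s where "s = (\<lambda>i. if i < j then Suc i else i)"
  have s: "bij_betw s ?J {1..N - 1}"
    by (rule bij_betwI[where g = "\<lambda>i. if i \<le> j then i - 1 else i"]) (use j in \<open>auto simp: s_def split: if_splits\<close>)
  have "poly p ?x = lead_coeff p * (\<Prod>r\<in>z ` {1..N - 1}. ?x - r)"
    by (subst p_eq) (simp add: poly_prod)
  also have "(\<Prod>r\<in>z ` {1..N - 1}. ?x - r) = (\<Prod>i\<in>{1..N - 1}. ?x - z i)"
    by (subst prod.reindex[OF z_inj]) simp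
  also have "\<dots> = (\<Prod>i\<in>?J. ?x - z (s i))"
    by (rule prod.reindex_bij_betw[OF s, symmetric])
  finally have p: "poly p ?x = lead_coeff p * (\<Prod>i\<in>?J. ?x - z (s i))" .
  have "(\<Prod>i\<in>?J. (?x - z (s i)) * (?x - X t i)) > 0"
  proof (rule prod_pos)
    fix i assume "i \<in> ?J"
    hence i: "i < N" "i \<noteq> j" by auto
    show "(?x - z (s i)) * (?x - X t i) > 0"
    proof (cases "i < j")
      case True
      thus ?thesis using X(1)[OF t j] X_less[OF t True j] z_le[of "Suc i" j] j
        by (auto simp: s_def intro!: mult_pos_pos)
    next
      case False
      thus ?thesis using X(2)[OF t j] X_less[OF t _ i(1), of j] z_le[of "Suc j" i] i
        by (auto simp: s_def intro!: mult_neg_neg)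
    qed
  qed
  hence "lead_coeff p * lead_coeff g * (\<Prod>i\<in>?J. (?x - z (s i)) * (?x - X t i)) > 0"
    using lc_p lc_g by simp
  thus ?thesis unfolding g' p by (simp add: prod.distrib mult_ac)
qed

lemma p_pderiv_g_pos_on_band:
  assumes "\<bar>poly g x\<bar> < 1"
  shows "poly p x * poly (pderiv g) x > 0"
  using root_is_X[OF assms] p_pderiv_g_pos[OF assms] by metis

text \<open>Residue theorem for \<open>f / (p (g - t))\<close>. The poles are the points
  \<open>X t j\<close> and the inner nodes, all simple; they are disjoint since \<open>g\<close> has
  modulus below \<open>1\<close> at the former and at least \<open>1\<close> at the latter. The
  denominator has degree \<open>2 N - 1\<close>, whence the coefficient at \<open>2 N - 2\<close> as
  contribution from infinity.\<close>

lemma residue_sum: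
  assumes t: "\<bar>t\<bar> < 1" and f: "degree f \<le> 2 * N - 2"
  shows "(\<Sum>j<N. poly f (X t j) / (poly p (X t j) * poly (pderiv g) (X t j))) =
    coeff f (2 * N - 2) / (lead_coeff p * lead_coeff g) -
    (\<Sum>j=1..N - 1. poly f (z j) / (poly (pderiv p) (z j) * (poly g (z j) - t)))"
proof -
  let ?q = "p * (g - [:t:])" and ?A = "X t ` {..<N}" and ?B = "z ` {1..N - 1}"
  have disj: "?A \<inter> ?B = {}"
  proof -
    have "X t i \<noteq> z j" if "i < N" "j \<in> {1..N - 1}" for i j
      using X(3)[OF t that(1)] g_z_abs[of j] t that(2) by (metis One_nat_def atLeastAtMost_iff diff_le_self le_trans not_le)
    thus ?thesis by auto
  qed
  have card: "card (?A \<union> ?B) = 2 * N - 1"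
    using disj X_inj[OF t] z_inj by (simp add: card_Un_disjoint card_image)
  have p0: "p \<noteq> 0" "g - [:t:] \<noteq> 0" using lc_p deg_g_minus(2)[of t] lc_g by auto
  have deg: "degree ?q = card (?A \<union> ?B)"
    using p0 N unfolding card by (simp add: degree_mult_eq deg_p deg_g_minus)
  have "(\<Sum>r\<in>?A \<union> ?B. poly f r / poly (pderiv ?q) r) = coeff f (card (?A \<union> ?B) - 1) / lead_coeff ?q"
  proof (rule sum_over_simple_roots)
    show "degree f < card (?A \<union> ?B)" using f N unfolding card by simp
    show "poly ?q r = 0" if "r \<in> ?A \<union> ?B" for r using that X(3)[OF t] p_z N by auto
  qed (use deg in auto)
  also have "(\<Sum>r\<in>?A \<union> ?B. poly f r / poly (pderiv ?q) r)
     = (\<Sum>r\<in>?A. poly f r / poly (pderiv ?q) r) + (\<Sum>r\<in>?B. poly f r / poly (pderiv ?q) r)"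
    using disj by (intro sum.union_disjoint) auto
  also have "(\<Sum>r\<in>?A. poly f r / poly (pderiv ?q) r)
      = (\<Sum>j<N. poly f (X t j) / (poly p (X t j) * poly (pderiv g) (X t j)))"
    using X(3)[OF t] by (subst sum.reindex[OF X_inj[OF t]])
      (auto simp: pderiv_mult pderiv_diff pderiv_pCons intro!: sum.cong)
  also have "(\<Sum>r\<in>?B. poly f r / poly (pderiv ?q) r)
      = (\<Sum>j=1..N - 1. poly f (z j) / (poly (pderiv p) (z j) * (poly g (z j) - t)))"
    using p_z N by (subst sum.reindex[OF z_inj])
      (auto simp: pderiv_mult pderiv_diff pderiv_pCons mult_ac intro!: sum.cong)
  finally show ?thesis using card unfolding lead_coeff_mult deg_g_minus(2)
    by (simp add: eq_diff_eq numeral_2_eq_2)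
qed

end

section \<open>Chebyshev polynomials and Poisson integrals\<close>

fun chebU :: "nat \<Rightarrow> real \<Rightarrow> real" where
  "chebU 0 t = 1"
| "chebU (Suc 0) t = 2 * t"
| "chebU (Suc (Suc n)) t = 2 * t * chebU (Suc n) t - chebU n t"

lemma sin_add_two: "sin ((real n + 2) * x) = 2 * cos x * sin ((real n + 1) * x) - sin (real n * x)"
proof -
  have "sin ((real n + 2) * x) = sin ((real n + 1) * x + x)"
    "sin (real n * x) = sin ((real n + 1) * x - x)" by (simp_all add: algebra_simps)
  thus ?thesis by (simp only: sin_add sin_diff) simp
qed

lemma sin_chebU: "sin x * chebU n (cos x) = sin (real (Suc n) * x)"
proof (induction n rule: induct_nat_012)
  case 1
  show ?case using sin_add_two[of 0 x] by (simp add: mult_ac)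
next
  case (ge2 n)
  have "sin x * chebU (Suc (Suc n)) (cos x)
      = 2 * cos x * (sin x * chebU (Suc n) (cos x)) - sin x * chebU n (cos x)"
    by (simp add: algebra_simps)
  also have "\<dots> = sin (real (Suc (Suc (Suc n))) * x)"
    using sin_add_two[of "Suc n" x] unfolding ge2 by (simp add: algebra_simps)
  finally show ?case .
qed simp

text \<open>The counterpart of \<open>sin_chebU\<close> with \<open>exp (i x)\<close> replaced by a
  real \<open>l\<close>.\<close>

lemma chebU_joukowski:
  assumes "l \<noteq> 0"
  shows "(l - inverse l) * chebU n ((l + inverse l) / 2) = l ^ Suc n - inverse l ^ Suc n"
proof (induction n rule: induct_nat_012)
  case 1
  show ?case using assms by (simp add: field_simps power2_eq_square)
next
  case (ge2 n)
  have "(l - inverse l) * chebU (Suc (Suc n)) ((l + inverse l) / 2)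
      = (l + inverse l) * ((l - inverse l) * chebU (Suc n) ((l + inverse l) / 2))
        - (l - inverse l) * chebU n ((l + inverse l) / 2)"
  proof -
    have e: "chebU (Suc (Suc n)) ((l + inverse l) / 2)
      = (l + inverse l) * chebU (Suc n) ((l + inverse l) / 2) - chebU n ((l + inverse l) / 2)"
      by simp
    show ?thesis unfolding e by (simp only: algebra_simps)
  qed
  also have "\<dots> = (l + inverse l) * (l ^ Suc (Suc n) - inverse l ^ Suc (Suc n))
      - (l ^ Suc n - inverse l ^ Suc n)"
    unfolding ge2 ..
  also have "\<dots> = l ^ Suc (Suc (Suc n)) - inverse l ^ Suc (Suc (Suc n))
      + (l * inverse l - 1) * (l ^ Suc n - inverse l ^ Suc n)"
    by (simp add: algebra_simps)
  finally show ?case using assms by simp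
qed simp

lemma continuous_on_chebU [continuous_intros]:
  "continuous_on S f \<Longrightarrow> continuous_on S (\<lambda>x. chebU n (f x))"
  by (induction n rule: induct_nat_012) (auto intro!: continuous_intros)

lemma integral_sin_sin:
  "((\<lambda>x. sin x * sin (real (Suc m) * x)) has_integral (if m = 0 then pi / 2 else 0)) {0..pi}"
proof -
  \<comment> \<open>A primitive from the product-to-sum formula; for \<open>m = 0\<close> the first
    cosine is constant and integrates to \<open>x\<close>.\<close>
  define F where "F = (\<lambda>x. (if m = 0 then x else sin (real m * x) / real m) / 2
      - sin (real (m + 2) * x) / (2 * real (m + 2)))"
  have e: "sin x * sin (real (Suc m) * x)
      = (if m = 0 then 1 else cos (real m * x)) / 2 - cos (real (m + 2) * x) / 2" for x
  proof -
    have "cos (real m * x) = cos (real (Suc m) * x - x)"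
      "cos (real (m + 2) * x) = cos (real (Suc m) * x + x)" by (simp_all add: algebra_simps)
    hence "cos (real m * x) - cos (real (m + 2) * x) = 2 * (sin x * sin (real (Suc m) * x))"
      by (simp only: cos_add cos_diff) simp
    thus ?thesis by auto
  qed
  have "((\<lambda>x. sin x * sin (real (Suc m) * x)) has_integral (F pi - F 0)) {0..pi}"
    unfolding e F_def
    by (rule fundamental_theorem_of_calculus)
       (auto intro!: derivative_eq_intros simp: has_real_derivative_iff_has_vector_derivative[symmetric]
         divide_simps, simp_all add: algebra_simps)
  moreover have "F pi - F 0 = (if m = 0 then pi / 2 else 0)"
    using sin_npi[of m] sin_npi[of "m + 2"] by (auto simp: F_def mult_ac simp del: sin_npi)
  ultimately show ?thesis by simp
qed

section \<open>Trigonometric integrals over \<open>(0, pi)\<close>\<close>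

lemma abs_integrable_bounded_pi:
  fixes f :: "real \<Rightarrow> real"
  assumes "continuous_on {0<..<pi} f" "\<And>x. x \<in> {0<..<pi} \<Longrightarrow> \<bar>f x\<bar> \<le> C"
  shows "f absolutely_integrable_on {0<..<pi}"
proof (rule measurable_bounded_by_integrable_imp_absolutely_integrable)
  show "f \<in> borel_measurable (lebesgue_on {0<..<pi})"
    by (intro continuous_imp_measurable_on_sets_lebesgue assms) auto
  show "(\<lambda>_. C) integrable_on {0<..<pi}"
    using integrable_on_open_interval[of "\<lambda>_. C" 0 pi] integrable_const_ivl[of C 0 pi]
    by (simp add: box_real)
qed (use assms in auto)

text \<open>The numerator compensates the singularity in the limit case
  \<open>\<bar>G\<bar> = 1\<close>, because
  \<open>1 - \<bar>cos x\<bar> \<le> \<bar>G - cos x\<bar>\<close>.\<close>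

lemma sin_sq_div_bound:
  fixes G x :: real
  assumes "\<bar>G\<bar> \<ge> 1"
  shows "\<bar>(sin x)\<^sup>2 / (G - cos x)\<bar> \<le> 2"
\<comment> \<open>When the denominator vanishes, the quotient is \<open>0\<close> by the convention
  on division.\<close>
proof (cases "G - cos x = 0")
  case False
  have "(sin x)\<^sup>2 = (1 + \<bar>cos x\<bar>) * (1 - \<bar>cos x\<bar>)"
    by (simp add: sin_squared_eq algebra_simps power2_eq_square)
  also have "\<dots> \<le> 2 * \<bar>G - cos x\<bar>"
    using assms abs_cos_le_one[of x] by (intro mult_mono) auto
  finally show ?thesis using False by (simp add: abs_divide pos_divide_le_eq)
qed simp

lemma cos_pi_interval:
  assumes "x \<in> {0<..<pi}"
  shows "\<bar>cos x\<bar> < 1" "sin x > 0"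
proof -
  show s: "sin x > 0" using assms by (simp add: sin_gt_zero)
  have "(cos x)\<^sup>2 < 1\<^sup>2" using s by (simp add: cos_squared_eq)
  thus "\<bar>cos x\<bar> < 1" by (simp add: abs_square_less_1)
qed

text \<open>With \<open>t = cos x\<close>: the Cauchy transform at \<open>G\<close> of
  \<open>U_m\<close> against the semicircle density \<open>2 / pi sqrt (1 - t^2)\<close>.\<close>

definition poissonI :: "real \<Rightarrow> nat \<Rightarrow> real" where
  "poissonI G m = integral {0<..<pi} (\<lambda>x. 2 / pi * (sin x)\<^sup>2 * (chebU m (cos x) / (G - cos x)))"

lemma sin_sq_chebU_abs_integrable:
  "(\<lambda>x. 2 / pi * (sin x)\<^sup>2 * chebU m (cos x)) absolutely_integrable_on {0<..<pi}"
  and sin_sq_chebU_integral: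
  "integral {0<..<pi} (\<lambda>x. 2 / pi * (sin x)\<^sup>2 * chebU m (cos x)) = (if m = 0 then 1 else 0)"
proof -
  have e: "2 / pi * (sin x)\<^sup>2 * chebU m (cos x) = 2 / pi * (sin x * sin (real (Suc m) * x))" for x
    unfolding sin_chebU[symmetric] by (simp add: power2_eq_square)
  have "\<bar>2 / pi * (sin x * sin (real (Suc m) * x))\<bar> \<le> 2 / pi" for x
  proof -
    have "\<bar>sin x\<bar> * \<bar>sin (real (Suc m) * x)\<bar> \<le> 1 * 1"
      by (intro mult_mono abs_sin_le_one) auto
    thus ?thesis by (simp add: abs_mult divide_right_mono)
  qed
  thus "(\<lambda>x. 2 / pi * (sin x)\<^sup>2 * chebU m (cos x)) absolutely_integrable_on {0<..<pi}"
    unfolding e by (intro abs_integrable_bounded_pi[where C = "2 / pi"] continuous_intros) auto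
  have "integral {0<..<pi} (\<lambda>x. 2 / pi * (sin x)\<^sup>2 * chebU m (cos x))
      = integral {0..pi} (\<lambda>x. 2 / pi * (sin x)\<^sup>2 * chebU m (cos x))"
    by (rule integral_open_interval_real[symmetric])
  also have "\<dots> = (if m = 0 then 1 else 0)"
    unfolding e using integral_unique[OF integral_sin_sin[of m]] by (simp split: if_splits)
  finally show "integral {0<..<pi} (\<lambda>x. 2 / pi * (sin x)\<^sup>2 * chebU m (cos x)) = (if m = 0 then 1 else 0)" .
qed

lemma chebU_bounded: "\<exists>C\<ge>0. \<forall>x. \<bar>chebU m (cos x)\<bar> \<le> C"
proof -
  have "compact (chebU m ` {-1..1})"
    by (intro compact_continuous_image continuous_intros) auto
  then obtain C where "\<forall>t\<in>{-1..1}. \<bar>chebU m t\<bar> \<le> C"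
    using compact_imp_bounded bounded_iff by (metis imageI real_norm_def)
  hence "\<forall>x. \<bar>chebU m (cos x)\<bar> \<le> C" by simp
  thus ?thesis by (meson abs_ge_zero order.trans)
qed

lemma poisson_abs_integrable:
  assumes "\<bar>G\<bar> \<ge> 1"
  shows "(\<lambda>x. 2 / pi * (sin x)\<^sup>2 * (chebU m (cos x) / (G - cos x))) absolutely_integrable_on {0<..<pi}"
proof -
  obtain C where C: "C \<ge> 0" "\<And>x. \<bar>chebU m (cos x)\<bar> \<le> C" using chebU_bounded by blast
  show ?thesis
  proof (rule abs_integrable_bounded_pi[where C = "2 / pi * (2 * C)"])
    show "continuous_on {0<..<pi} (\<lambda>x. 2 / pi * (sin x)\<^sup>2 * (chebU m (cos x) / (G - cos x)))"
      using assms cos_pi_interval(1) by (intro continuous_intros) fastforce+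
    fix x
    have "\<bar>(sin x)\<^sup>2 / (G - cos x)\<bar> * \<bar>chebU m (cos x)\<bar> \<le> 2 * C"
      using C sin_sq_div_bound[OF assms] by (intro mult_mono) auto
    hence "2 / pi * (\<bar>(sin x)\<^sup>2 / (G - cos x)\<bar> * \<bar>chebU m (cos x)\<bar>) \<le> 2 / pi * (2 * C)"
      by (intro mult_left_mono) auto
    thus "\<bar>2 / pi * (sin x)\<^sup>2 * (chebU m (cos x) / (G - cos x))\<bar> \<le> 2 / pi * (2 * C)"
      by (simp add: abs_mult abs_divide)
  qed
qed

text \<open>In the Chebyshev recurrence write \<open>2 cos x = 2 G - 2 (G - cos x)\<close>. The
  second term cancels the denominator and leaves the integral of \<open>sin^2 U_m\<close>, which
  vanishes except for \<open>m = 0\<close>; that exception is the \<open>- 2\<close>.\<close>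

lemma poissonI_rec:
  assumes G: "\<bar>G\<bar> \<ge> 1"
  shows "poissonI G (Suc 0) = 2 * G * poissonI G 0 - 2"
    and "poissonI G (Suc (Suc m)) = 2 * G * poissonI G (Suc m) - poissonI G m"
proof -
  let ?f = "\<lambda>m x. 2 / pi * (sin x)\<^sup>2 * (chebU m (cos x) / (G - cos x))"
  let ?u = "\<lambda>m x. 2 / pi * (sin x)\<^sup>2 * chebU m (cos x)"
  have f: "(?f m has_integral poissonI G m) {0<..<pi}" for m
    unfolding poissonI_def using poisson_abs_integrable[OF G]
    by (intro integrable_integral set_lebesgue_integral_eq_integral(1))
  have u: "(?u m has_integral (if m = 0 then 1 else 0)) {0<..<pi}" for m
    unfolding sin_sq_chebU_integral[of m, symmetric] using sin_sq_chebU_abs_integrable[of m]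
    by (intro integrable_integral set_lebesgue_integral_eq_integral(1))
  have nz: "G - cos x \<noteq> 0" if "x \<in> {0<..<pi}" for x
    using cos_pi_interval(1)[OF that] G by auto
  have "((\<lambda>x. 2 * G * ?f 0 x - 2 * ?u 0 x) has_integral (2 * G * poissonI G 0 - 2 * 1)) {0<..<pi}"
    using f[of 0] u[of 0] by (intro has_integral_diff has_integral_mult_right) auto
  moreover have "?f (Suc 0) x = 2 * G * ?f 0 x - 2 * ?u 0 x" if x: "x \<in> {0<..<pi}" for x
  proof -
    have "chebU (Suc 0) (cos x) / (G - cos x) = (2 * G - 2 * (G - cos x)) / (G - cos x)"
      by simp
    also have "\<dots> = 2 * G / (G - cos x) - 2"
      by (simp only: diff_divide_distrib
        nonzero_mult_div_cancel_right[OF nz[OF x]])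
    finally show ?thesis by (simp only: chebU.simps(1)) (simp add: algebra_simps)
  qed
  ultimately have "(?f (Suc 0) has_integral (2 * G * poissonI G 0 - 2 * 1)) {0<..<pi}"
    by (subst has_integral_cong) auto
  from has_integral_unique[OF f[of "Suc 0"] this]
  show "poissonI G (Suc 0) = 2 * G * poissonI G 0 - 2" by simp
  have "((\<lambda>x. 2 * G * ?f (Suc m) x - ?f m x - 2 * ?u (Suc m) x) has_integral
      (2 * G * poissonI G (Suc m) - poissonI G m - 2 * 0)) {0<..<pi}"
    using f[of m] f[of "Suc m"] u[of "Suc m"] by (intro has_integral_diff has_integral_mult_right) auto
  moreover have "?f (Suc (Suc m)) x = 2 * G * ?f (Suc m) x - ?f m x - 2 * ?u (Suc m) x"
    if x: "x \<in> {0<..<pi}" for x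
  proof -
    let ?U = "\<lambda>m. chebU m (cos x)"
    have "?U (Suc (Suc m)) / (G - cos x)
        = (2 * G * ?U (Suc m) - ?U m - 2 * ?U (Suc m) * (G - cos x)) / (G - cos x)"
      by (simp add: algebra_simps)
    also have "\<dots> = 2 * G * (?U (Suc m) / (G - cos x)) - ?U m / (G - cos x) - 2 * ?U (Suc m)"
      using nz[OF x] by (simp only: diff_divide_distrib) simp
    finally show ?thesis by (simp only:) (simp add: algebra_simps del: chebU.simps)
  qed
  ultimately have "(?f (Suc (Suc m)) has_integral (2 * G * poissonI G (Suc m) - poissonI G m - 2 * 0)) {0<..<pi}"
    by (subst has_integral_cong) (auto simp del: chebU.simps)
  from has_integral_unique[OF f[of "Suc (Suc m)"] this]
  show "poissonI G (Suc (Suc m)) = 2 * G * poissonI G (Suc m) - poissonI G m" by simp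
qed

text \<open>Arithmetic-geometric mean inequality, with excess
  \<open>(\<bar>r\<bar> - 1)^2 / (2 \<bar>r\<bar>)\<close> over \<open>1\<close>.\<close>

lemma abs_joukowski_ge:
  fixes r :: real
  assumes "r \<noteq> 0"
  shows "\<bar>(r + inverse r) / 2\<bar> \<ge> 1" and "\<bar>r\<bar> \<noteq> 1 \<Longrightarrow> \<bar>(r + inverse r) / 2\<bar> > 1"
proof -
  have "\<bar>r + inverse r\<bar> = \<bar>r\<bar> + inverse \<bar>r\<bar>"
  proof (cases "r > 0")
    case True
    hence "r + inverse r > 0" by (simp add: add_pos_pos)
    thus ?thesis using True by simp
  next
    case False
    hence "r < 0" "r + inverse r < 0" using assms by (auto intro!: add_neg_neg)
    thus ?thesis by simp
  qed
  have e: "\<bar>(r + inverse r) / 2\<bar> = 1 + (\<bar>r\<bar> - 1)\<^sup>2 / (2 * \<bar>r\<bar>)"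
  proof -
    have "(u + inverse u) / 2 = 1 + (u - 1)\<^sup>2 / (2 * u)" if "u > 0" for u :: real
      using that by (simp add: field_simps power2_eq_square)
    from this[of "\<bar>r\<bar>"] show ?thesis
      using assms \<open>\<bar>r + inverse r\<bar> = \<bar>r\<bar> + inverse \<bar>r\<bar>\<close> by (simp add: abs_divide)
  qed
  show "\<bar>(r + inverse r) / 2\<bar> \<ge> 1" unfolding e by simp
  show "\<bar>(r + inverse r) / 2\<bar> > 1" if "\<bar>r\<bar> \<noteq> 1"
    unfolding e using assms that by simp
qed

text \<open>The bound is uniform in \<open>m\<close>: one factor \<open>sin x\<close> is absorbed
  into \<open>U_m\<close>, which gives \<open>sin ((m + 1) x)\<close>, of modulus at most
  \<open>1\<close>.\<close>

lemma poissonI_bounded: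
  assumes G: "\<bar>G\<bar> > 1"
  shows "\<bar>poissonI G m\<bar> \<le> 2 / (\<bar>G\<bar> - 1)"
proof -
  let ?K = "2 / pi * (1 / (\<bar>G\<bar> - 1))"
  have "norm (poissonI G m) \<le> integral {0<..<pi} (\<lambda>_. ?K)"
    unfolding poissonI_def
  proof (rule integral_norm_bound_integral)
    show "(\<lambda>x. 2 / pi * (sin x)\<^sup>2 * (chebU m (cos x) / (G - cos x))) integrable_on {0<..<pi}"
      using G by (intro set_lebesgue_integral_eq_integral(1) poisson_abs_integrable) simp
    show "(\<lambda>_. ?K) integrable_on {0<..<pi}"
      using integrable_on_open_interval[of "\<lambda>_. ?K" 0 pi] integrable_const_ivl[of ?K 0 pi]
      by (simp add: box_real)
    fix x
    have e: "2 / pi * (sin x)\<^sup>2 * (chebU m (cos x) / (G - cos x))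
        = 2 / pi * (sin x * sin (real (Suc m) * x) / (G - cos x))"
      unfolding sin_chebU[symmetric] by (simp add: power2_eq_square)
    have "\<bar>sin x * sin (real (Suc m) * x)\<bar> \<le> 1 * 1"
      unfolding abs_mult by (intro mult_mono abs_sin_le_one) auto
    moreover have "\<bar>G - cos x\<bar> \<ge> \<bar>G\<bar> - 1" using abs_cos_le_one[of x] by linarith
    ultimately have "\<bar>sin x * sin (real (Suc m) * x) / (G - cos x)\<bar> \<le> 1 / (\<bar>G\<bar> - 1)"
      unfolding abs_divide using G by (intro frac_le) auto
    hence "2 / pi * \<bar>sin x * sin (real (Suc m) * x) / (G - cos x)\<bar> \<le> ?K"
      by (rule mult_left_mono) simp
    thus "norm (2 / pi * (sin x)\<^sup>2 * (chebU m (cos x) / (G - cos x))) \<le> ?K"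
      unfolding e real_norm_def abs_mult[of "2 / pi"] by (subst abs_of_pos) simp_all
  qed
  also have "integral {0<..<pi} (\<lambda>_. ?K) = integral {0..pi} (\<lambda>_. ?K)"
    by (rule integral_open_interval_real[symmetric])
  also have "\<dots> = 2 / (\<bar>G\<bar> - 1)" by simp
  finally show ?thesis by simp
qed

text \<open>Since \<open>r^2 = 1\<close>, the denominator divides
  \<open>sin^2 x = (r + cos x) (r - cos x)\<close>.\<close>

lemma poissonI_pm1:
  assumes "\<bar>r\<bar> = 1"
  shows "poissonI r 0 = 2 * r"
proof -
  have "poissonI r 0 = integral {0<..<pi} (\<lambda>x. 2 / pi * (r + cos x))"
    unfolding poissonI_def
  proof (rule Henstock_Kurzweil_Integration.integral_cong)
    fix x assume "x \<in> {0<..<pi}"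
    hence nz: "r - cos x \<noteq> 0" using cos_pi_interval(1)[of x] assms by auto
    have "r\<^sup>2 = 1" using assms by (metis power2_abs one_power2)
    hence "(sin x)\<^sup>2 = (r + cos x) * (r - cos x)"
      by (simp add: sin_squared_eq algebra_simps power2_eq_square)
    thus "2 / pi * (sin x)\<^sup>2 * (chebU 0 (cos x) / (r - cos x)) = 2 / pi * (r + cos x)"
      using nz by simp
  qed
  also have "\<dots> = integral {0..pi} (\<lambda>x. 2 / pi * (r + cos x))"
    by (rule integral_open_interval_real[symmetric])
  also have "\<dots> = 2 / pi * (r * pi + sin pi) - 2 / pi * (r * 0 + sin 0)"
    by (intro integral_unique fundamental_theorem_of_calculus)
       (auto intro!: derivative_eq_intros simp: has_real_derivative_iff_has_vector_derivative[symmetric])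
  finally show ?thesis by simp
qed

text \<open>The differences \<open>I\<^sub>m\<^sub>+\<^sub>1 - r I\<^sub>m\<close> are multiplied by \<open>1/r\<close> in each step but stay
  bounded, so for \<open>\<bar>r\<bar> < 1\<close> they all vanish.\<close>

lemma poissonI_eq:
  assumes r: "r \<noteq> 0" "\<bar>r\<bar> \<le> 1"
  shows "poissonI ((r + inverse r) / 2) m = 2 * r ^ Suc m"
proof -
  define G where "G = (r + inverse r) / 2"
  have G1: "\<bar>G\<bar> \<ge> 1" unfolding G_def by (rule abs_joukowski_ge(1)[OF r(1)])
  have GG: "2 * G = r + inverse r" by (simp add: G_def)
  have I0: "poissonI G 0 = 2 * r"
  \<comment> \<open>On the boundary \<open>\<bar>G\<bar> = 1\<close> there is no uniform bound, so
    the value is computed directly.\<close>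
  proof (cases "\<bar>r\<bar> = 1")
    case True
    hence "G = r" by (auto simp: G_def abs_if split: if_splits)
    thus ?thesis using poissonI_pm1[OF True] by simp
  next
    case False
    define D where "D = (\<lambda>m. poissonI G (Suc m) - r * poissonI G m)"
    have "D (Suc m) = inverse r * D m" for m
      using r(1) unfolding D_def poissonI_rec(2)[OF G1] GG by (simp add: algebra_simps)
    hence "r * D (Suc m) = D m" for m using r(1) by simp
    hence step: "r ^ Suc m * D (Suc m) = r ^ m * D m" for m
      by (simp add: mult.assoc mult.left_commute)
    have Dm: "r ^ m * D m = D 0" for m by (induction m) (simp, simp only: step)
    have G: "\<bar>G\<bar> > 1" using abs_joukowski_ge(2)[OF r(1) False] by (simp add: G_def)
    define C where "C = 2 / (\<bar>G\<bar> - 1)"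
    have I: "\<bar>poissonI G m\<bar> \<le> C" for m unfolding C_def by (rule poissonI_bounded[OF G])
    have "\<bar>D 0\<bar> \<le> \<bar>r\<bar> ^ m * (2 * C)" for m
    proof -
      have "\<bar>r * poissonI G m\<bar> \<le> 1 * C" unfolding abs_mult using I r by (intro mult_mono) auto
      hence "\<bar>D m\<bar> \<le> 2 * C" using I[of "Suc m"] by (simp add: D_def)
      hence "\<bar>r\<bar> ^ m * \<bar>D m\<bar> \<le> \<bar>r\<bar> ^ m * (2 * C)" by (intro mult_left_mono) auto
      thus ?thesis using Dm[of m] by (metis abs_mult power_abs)
    qed
    moreover have "(\<lambda>m. \<bar>r\<bar> ^ m * (2 * C)) \<longlonglongrightarrow> 0 * (2 * C)"
      using r False by (intro tendsto_intros LIMSEQ_realpow_zero) auto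
    ultimately have "\<bar>D 0\<bar> \<le> 0 * (2 * C)"
      by (intro LIMSEQ_le_const) auto
    \<comment> \<open>\<open>D 0 = 0\<close> suffices: together with the inhomogeneous first
      recurrence it determines the value at \<open>0\<close>.\<close>
    hence "poissonI G (Suc 0) = r * poissonI G 0" by (simp add: D_def)
    hence "inverse r * poissonI G 0 = 2"
      unfolding poissonI_rec(1)[OF G1] GG by (simp add: algebra_simps)
    thus ?thesis using r(1) by (simp add: field_simps)
  qed
  have "poissonI G m = 2 * r ^ Suc m"
  proof (induction m rule: induct_nat_012)
    case 1
    show ?case unfolding poissonI_rec(1)[OF G1] GG I0 using r(1) by (simp add: field_simps)
  next
    case (ge2 m)
    show ?case unfolding poissonI_rec(2)[OF G1] GG ge2 using r(1) by (simp add: field_simps)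
  qed (simp add: I0)
  thus ?thesis by (simp add: G_def)
qed

text \<open>The integral is expressed by whichever of \<open>l\<close>, \<open>1/l\<close> lies in
  the closed unit disc. The correction, which will come from the point mass, exchanges
  \<open>l\<close> for \<open>1/l\<close> when \<open>\<bar>l\<bar> < 1\<close>, so one formula
  covers all \<open>l\<close>.\<close>

lemma poissonI_eq_residue:
  assumes "l \<noteq> 0"
  defines "G \<equiv> (l + inverse l) / 2"
  shows "poissonI G m - (if \<bar>l\<bar> < 1 then 2 * (l - inverse l) * chebU m G else 0)
    = 2 * inverse l ^ Suc m"
proof (cases "\<bar>l\<bar> < 1")
  case True
  have "2 * (l - inverse l) * chebU m G = 2 * (l ^ Suc m - inverse l ^ Suc m)"
    unfolding mult.assoc G_def chebU_joukowski[OF assms(1)] ..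
  thus ?thesis using poissonI_eq[of l m] assms True by simp
next
  case False
  hence "\<bar>inverse l\<bar> \<le> 1" using assms(1) by (simp add: abs_inverse inverse_le_1_iff)
  moreover have "(inverse l + inverse (inverse l)) / 2 = G" by (simp add: G_def add.commute)
  ultimately show ?thesis using poissonI_eq[of "inverse l" m] assms(1) False by simp
qed

section \<open>Integration over the bands\<close>

context interlacing begin

definition B :: "real set" where "B = {x. \<bar>poly g x\<bar> < 1}"

definition branch :: "nat \<Rightarrow> real set" where "branch j = {z j<..<z (Suc j)} \<inter> B"

definition \<omega> :: "real \<Rightarrow> real" where
  "\<omega> x = 2 * sqrt \<bar>1 - (poly g x)\<^sup>2\<bar> / (pi * \<bar>poly p x\<bar>)"

lemma open_B: "open B"
  unfolding B_def by (intro open_Collect_less continuous_intros)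

lemma open_branch: "open (branch j)"
  unfolding branch_def by (intro open_Int open_B) auto

lemma X_in_branch: "\<bar>t\<bar> < 1 \<Longrightarrow> j < N \<Longrightarrow> X t j \<in> branch j"
  using X[of t j] by (auto simp: branch_def B_def)

lemma branch_X: "x \<in> branch j \<Longrightarrow> j < N \<Longrightarrow> X (poly g x) j = x"
  using root_in_interval[of x j] by (auto simp: branch_def B_def)

lemma B_eq: "B = (\<Union>j<N. branch j)"
proof (intro equalityI subsetI)
  fix x assume x: "x \<in> B"
  hence t: "\<bar>poly g x\<bar> < 1" by (simp add: B_def)
  then obtain j where "j < N" "x = X (poly g x) j" using root_is_X by blast
  thus "x \<in> (\<Union>j<N. branch j)" using X_in_branch[OF t] by (metis UN_I lessThan_iff)
qed (auto simp: branch_def)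

lemma branch_disjoint: "i < j \<Longrightarrow> j < N \<Longrightarrow> branch i \<inter> branch j = {}"
  using z_le[of "Suc i" j] by (auto simp: branch_def)

text \<open>All terms of the residue sum for \<open>f = 1\<close> are positive, so each is at most
  the whole sum; \<open>residue_sum\<close> turns that sum into quotients that the factor
  \<open>sin^2\<close> keeps bounded.\<close>

lemma inv_p_pderiv_g_bounded:
  "\<exists>C. \<forall>x\<in>{0<..<pi}. \<forall>j<N.
     \<bar>(sin x)\<^sup>2 / (poly p (X (cos x) j) * poly (pderiv g) (X (cos x) j))\<bar> \<le> C"
proof (intro exI ballI allI impI)
  let ?h = "\<lambda>t j. poly p (X t j) * poly (pderiv g) (X t j)"
  let ?k = "coeff 1 (2 * N - 2) / (lead_coeff p * lead_coeff g)"
  fix x j assume x: "x \<in> {0<..<pi}" and j: "j < N"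
  have t: "\<bar>cos x\<bar> < 1" by (rule cos_pi_interval(1)[OF x])
  have h: "?h (cos x) i > 0" if "i < N" for i using p_pderiv_g_pos[OF t that] .
  have "\<bar>(sin x)\<^sup>2 / ?h (cos x) j\<bar> = (sin x)\<^sup>2 * (1 / ?h (cos x) j)" using h[OF j] by simp
  also have "\<dots> \<le> (sin x)\<^sup>2 * (\<Sum>i<N. 1 / ?h (cos x) i)"
    using h j by (intro mult_left_mono member_le_sum) (auto simp: less_imp_le)
  also have "(\<Sum>i<N. 1 / ?h (cos x) i) =
      ?k - (\<Sum>j=1..N - 1. 1 / (poly (pderiv p) (z j) * (poly g (z j) - cos x)))"
    using residue_sum[OF t, of 1] by simp
  also have "(sin x)\<^sup>2 * \<dots> = (sin x)\<^sup>2 * ?k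
      - (\<Sum>j=1..N - 1. (sin x)\<^sup>2 / (poly g (z j) - cos x) * (1 / poly (pderiv p) (z j)))"
    by (simp add: right_diff_distrib sum_distrib_left mult_ac)
  also have "\<dots> \<le> \<bar>?k\<bar> + (\<Sum>j=1..N - 1. 2 * \<bar>1 / poly (pderiv p) (z j)\<bar>)"
  proof -
    have "(sin x)\<^sup>2 * ?k \<le> 1 * \<bar>?k\<bar>"
      by (intro order.trans[OF mult_left_mono mult_right_mono] abs_ge_self)
         (auto simp: abs_square_le_1)
    moreover have "\<bar>\<Sum>j=1..N - 1. (sin x)\<^sup>2 / (poly g (z j) - cos x) * (1 / poly (pderiv p) (z j))\<bar>
        \<le> (\<Sum>j=1..N - 1. 2 * \<bar>1 / poly (pderiv p) (z j)\<bar>)"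
      using sin_sq_div_bound[OF g_z_abs]
      by (intro order.trans[OF sum_abs] sum_mono, unfold abs_mult, intro mult_right_mono) auto
    ultimately show ?thesis by linarith
  qed
  finally show "\<bar>(sin x)\<^sup>2 / ?h (cos x) j\<bar> \<le> \<bar>?k\<bar> + (\<Sum>j=1..N - 1. 2 * \<bar>1 / poly (pderiv p) (z j)\<bar>)" .
qed

text \<open>Substitution \<open>\<theta> = arccos (g x)\<close>, which maps the branch onto
  \<open>(0, pi)\<close> with inverse \<open>X (cos \<theta>) j\<close>. The Jacobian contains
  \<open>\<bar>g'\<bar>\<close>, and \<open>p g' > 0\<close> supplies the sign that turns
  \<open>\<omega>\<close> into \<open>2 / pi sin^2 / (p g')\<close>.\<close>

lemma branch_integral:
  assumes F: "continuous_on UNIV F" and j: "j < N"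
  defines "f \<equiv> (\<lambda>x. 2 / pi * (sin x)\<^sup>2 * (F (X (cos x) j) /
      (poly p (X (cos x) j) * poly (pderiv g) (X (cos x) j))))"
  shows "f absolutely_integrable_on {0<..<pi}"
    and "(\<lambda>x. F x * \<omega> x) absolutely_integrable_on branch j"
    and "integral (branch j) (\<lambda>x. F x * \<omega> x) = integral {0<..<pi} f"
proof -
  define \<phi> where "\<phi> = (\<lambda>x. arccos (poly g x))"
  have range: "\<bar>poly g x\<bar> < 1" "-1 < poly g x" "poly g x < 1" "cos (\<phi> x) = poly g x"
    if "x \<in> branch j" for x
    using that by (auto simp: branch_def B_def \<phi>_def abs_less_iff intro!: cos_arccos)
  have der: "(\<phi> has_field_derivative (- poly (pderiv g) x / sqrt (1 - (poly g x)\<^sup>2))) (at x within branch j)"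
    if "x \<in> branch j" for x
    unfolding \<phi>_def using range[OF that]
    by (auto intro!: derivative_eq_intros simp: divide_simps)
  have inj: "inj_on \<phi> (branch j)"
    using range(4) branch_X[OF _ j] by (metis inj_onI)
  have X_\<phi>: "\<phi> (X (cos x) j) = x" "X (cos x) j \<in> branch j" if "x \<in> {0<..<pi}" for x
    using that cos_pi_interval(1)[OF that] X(3)[OF _ j] X_in_branch[OF _ j]
    by (auto simp: \<phi>_def arccos_cos)
  have image: "\<phi> ` branch j = {0<..<pi}"
  proof (intro equalityI subsetI)
    fix y assume "y \<in> \<phi> ` branch j"
    thus "y \<in> {0<..<pi}" using range arccos_lt_bounded by (auto simp: \<phi>_def)
  next
    fix y assume "y \<in> {0<..<pi}"
    thus "y \<in> \<phi> ` branch j" using X_\<phi> by (metis imageI)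
  qed
  have cont_\<phi>: "continuous_on (branch j) \<phi>"
    using der by (meson DERIV_continuous continuous_on_eq_continuous_within)
  \<comment> \<open>Invariance of domain makes the inverse continuous; this is how continuity of
    \<open>X\<close> in its level is obtained.\<close>
  obtain \<psi> where \<psi>: "homeomorphism (branch j) (\<phi> ` branch j) \<phi> \<psi>"
    using invariance_of_domain_homeomorphism[OF open_branch cont_\<phi> _ inj] by auto
  have "\<psi> x = X (cos x) j" if "x \<in> {0<..<pi}" for x
    using X_\<phi>[OF that] \<psi> by (metis homeomorphism_apply1)
  moreover have "continuous_on {0<..<pi} \<psi>"
    using \<psi> unfolding image by (simp add: homeomorphism_def)
  ultimately have cont_X: "continuous_on {0<..<pi} (\<lambda>x. X (cos x) j)"
    by (metis (no_types, lifting) continuous_on_eq)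
  have cont_F: "continuous_on {0<..<pi} (\<lambda>x. F (X (cos x) j))"
    by (rule continuous_on_compose2[OF F cont_X]) auto
  have pos: "poly p (X (cos x) j) * poly (pderiv g) (X (cos x) j) > 0" if "x \<in> {0<..<pi}" for x
    by (rule p_pderiv_g_pos[OF cos_pi_interval(1)[OF that] j])
  have cont_f: "continuous_on {0<..<pi} f"
    unfolding f_def by (intro continuous_intros cont_F cont_X) (use pos in force)
  obtain C where C: "\<And>x. x \<in> {0<..<pi} \<Longrightarrow>
      \<bar>(sin x)\<^sup>2 / (poly p (X (cos x) j) * poly (pderiv g) (X (cos x) j))\<bar> \<le> C"
    using inv_p_pderiv_g_bounded j by blast
  have "compact (F ` {z 0..z N})"
    by (intro compact_continuous_image continuous_on_subset[OF F]) auto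
  then obtain M where M: "\<And>x. x \<in> {z 0..z N} \<Longrightarrow> \<bar>F x\<bar> \<le> M"
    using compact_imp_bounded bounded_iff by (metis imageI real_norm_def)
  show f_int: "f absolutely_integrable_on {0<..<pi}"
  proof (rule abs_integrable_bounded_pi[OF cont_f])
    fix x :: real assume x: "x \<in> {0<..<pi}"
    let ?x = "X (cos x) j"
    have "?x \<in> {z 0..z N}"
      using X[OF cos_pi_interval(1)[OF x] j] z_le[of 0 j] z_le[of "Suc j" N] j by auto
    hence "2 / pi * (\<bar>F ?x\<bar> * \<bar>(sin x)\<^sup>2 / (poly p ?x * poly (pderiv g) ?x)\<bar>) \<le> 2 / pi * (M * C)"
      using C[OF x] M[of ?x] by (intro mult_left_mono mult_mono) auto
    thus "\<bar>f x\<bar> \<le> 2 / pi * (M * C)" by (simp add: f_def abs_mult mult_ac)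
  qed
  have eq: "\<bar>- poly (pderiv g) x / sqrt (1 - (poly g x)\<^sup>2)\<bar> * f (\<phi> x) = F x * \<omega> x"
    if x: "x \<in> branch j" for x
  proof -
    have pg: "poly p x * poly (pderiv g) x > 0"
      using p_pderiv_g_pos_on_band[OF range(1)[OF x]] .
    define s where "s = sqrt (1 - (poly g x)\<^sup>2)"
    have g1: "1 - (poly g x)\<^sup>2 > 0" using range(1)[OF x] by (simp add: abs_square_less_1)
    have s: "s > 0" using g1 by (simp add: s_def)
    have sin: "sin (\<phi> x) = s"
      unfolding \<phi>_def s_def using range[OF x] by (intro sin_arccos) auto
    have quot: "\<bar>poly (pderiv g) x\<bar> / (poly p x * poly (pderiv g) x) = 1 / \<bar>poly p x\<bar>"
      using pg by (auto simp: zero_less_mult_iff field_simps)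
    have f\<phi>: "f (\<phi> x) = 2 / pi * s\<^sup>2 * (F x / (poly p x * poly (pderiv g) x))"
      unfolding f_def sin range(4)[OF x] branch_X[OF x j] ..
    have "\<bar>poly (pderiv g) x\<bar> / s * f (\<phi> x)
        = F x * (2 * s / pi) * (\<bar>poly (pderiv g) x\<bar> / (poly p x * poly (pderiv g) x))"
      unfolding f\<phi> using s by (simp add: power2_eq_square)
    also have "\<dots> = F x * (2 * s / (pi * \<bar>poly p x\<bar>))" unfolding quot by simp
    finally have "\<bar>poly (pderiv g) x\<bar> / s * f (\<phi> x) = F x * (2 * s / (pi * \<bar>poly p x\<bar>))" .
    thus ?thesis using s g1 by (simp add: \<omega>_def s_def)
  qed
  let ?G = "\<lambda>x. \<bar>- poly (pderiv g) x / sqrt (1 - (poly g x)\<^sup>2)\<bar> * f (\<phi> x)"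
  have sets: "branch j \<in> sets lebesgue" using open_branch by auto
  have *: "?G absolutely_integrable_on branch j \<and> integral (branch j) ?G = integral {0<..<pi} f"
    using has_absolute_integral_change_of_variables_1'[OF sets der inj, of f "integral {0<..<pi} f"]
      f_int unfolding image by blast
  have "?G absolutely_integrable_on branch j \<longleftrightarrow> (\<lambda>x. F x * \<omega> x) absolutely_integrable_on branch j"
    by (rule set_integrable_cong[OF refl refl eq])
  thus "(\<lambda>x. F x * \<omega> x) absolutely_integrable_on branch j" using * by blast
  have "integral (branch j) ?G = integral (branch j) (\<lambda>x. F x * \<omega> x)"
    by (rule Henstock_Kurzweil_Integration.integral_cong[OF eq])
  thus "integral (branch j) (\<lambda>x. F x * \<omega> x) = integral {0<..<pi} f" using * by metis
qed

lemma B_integral: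
  assumes F: "continuous_on UNIV F"
  shows "(\<lambda>x. F x * \<omega> x) absolutely_integrable_on B"
    and "integral B (\<lambda>x. F x * \<omega> x) = integral {0<..<pi} (\<lambda>x. 2 / pi * (sin x)\<^sup>2 *
      (\<Sum>j<N. F (X (cos x) j) / (poly p (X (cos x) j) * poly (pderiv g) (X (cos x) j))))"
proof -
  let ?f = "\<lambda>j x. 2 / pi * (sin x)\<^sup>2 * (F (X (cos x) j) /
      (poly p (X (cos x) j) * poly (pderiv g) (X (cos x) j)))"
  note * = branch_integral[OF F]
  show "(\<lambda>x. F x * \<omega> x) absolutely_integrable_on B"
    unfolding B_eq using *(2) open_branch by (intro set_integrable_UN) auto
  have "((\<lambda>x. F x * \<omega> x) has_integral (\<Sum>j<N. integral {0<..<pi} (?f j))) B"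
    unfolding B_eq
  proof (rule has_integral_UN)
    show "((\<lambda>x. F x * \<omega> x) has_integral integral {0<..<pi} (?f j)) (branch j)" if "j \<in> {..<N}" for j
      using that unfolding *(3)[of j, OF that[THEN lessThan_iff[THEN iffD1]], symmetric]
      by (intro integrable_integral set_lebesgue_integral_eq_integral(1) *(2)) auto
    show "pairwise (\<lambda>i i'. negligible (branch i \<inter> branch i')) {..<N}"
    proof (rule pairwiseI)
      fix i j assume "i \<in> {..<N}" "j \<in> {..<N}" "i \<noteq> j"
      hence "branch i \<inter> branch j = {}"
        using branch_disjoint[of i j] branch_disjoint[of j i] by (cases "i < j") auto
      thus "negligible (branch i \<inter> branch j)" by simp
    qed
  qed auto
  hence "integral B (\<lambda>x. F x * \<omega> x) = (\<Sum>j<N. integral {0<..<pi} (?f j))" by (rule integral_unique)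
  also have "\<dots> = integral {0<..<pi} (\<lambda>x. \<Sum>j<N. ?f j x)"
    using *(1) by (intro integral_sum[symmetric]) (auto intro: set_lebesgue_integral_eq_integral(1))
  finally show "integral B (\<lambda>x. F x * \<omega> x) = integral {0<..<pi} (\<lambda>x. 2 / pi * (sin x)\<^sup>2 *
      (\<Sum>j<N. F (X (cos x) j) / (poly p (X (cos x) j) * poly (pderiv g) (X (cos x) j))))"
    by (simp add: sum_distrib_left)
qed

text \<open>On every branch \<open>g\<close> equals \<open>cos x\<close>, so the Chebyshev factor
  comes out of the sum over the branches; what remains is a residue sum, integrated term by
  term.\<close>

lemma B_integral_chebU:
  assumes f: "degree f \<le> 2 * N - 2"
  shows "integral B (\<lambda>x. poly f x * chebU m (poly g x) * \<omega> x) =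
    (if m = 0 then coeff f (2 * N - 2) / (lead_coeff p * lead_coeff g) else 0) -
    (\<Sum>j=1..N - 1. poly f (z j) / poly (pderiv p) (z j) * poissonI (poly g (z j)) m)"
proof -
  let ?k = "coeff f (2 * N - 2) / (lead_coeff p * lead_coeff g)"
  let ?h = "\<lambda>x. ?k * (2 / pi * (sin x)\<^sup>2 * chebU m (cos x)) - (\<Sum>j=1..N - 1.
     poly f (z j) / poly (pderiv p) (z j) *
       (2 / pi * (sin x)\<^sup>2 * (chebU m (cos x) / (poly g (z j) - cos x))))"
  have "continuous_on UNIV (\<lambda>x. poly f x * chebU m (poly g x))"
    by (intro continuous_intros)
  from B_integral(2)[OF this]
  have "integral B (\<lambda>x. poly f x * chebU m (poly g x) * \<omega> x) =
    integral {0<..<pi} (\<lambda>x. 2 / pi * (sin x)\<^sup>2 *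
      (\<Sum>j<N. poly f (X (cos x) j) * chebU m (poly g (X (cos x) j)) /
        (poly p (X (cos x) j) * poly (pderiv g) (X (cos x) j))))" .
  also have "\<dots> = integral {0<..<pi} ?h"
  proof (rule Henstock_Kurzweil_Integration.integral_cong)
    fix x assume x: "x \<in> {0<..<pi}"
    have t: "\<bar>cos x\<bar> < 1" by (rule cos_pi_interval(1)[OF x])
    let ?d = "\<lambda>j. poly p (X (cos x) j) * poly (pderiv g) (X (cos x) j)"
    have "(\<Sum>j<N. poly f (X (cos x) j) * chebU m (poly g (X (cos x) j)) / ?d j)
      = chebU m (cos x) * (\<Sum>j<N. poly f (X (cos x) j) / ?d j)"
      unfolding sum_distrib_left using X(3)[OF t] by (intro sum.cong) auto
    thus "2 / pi * (sin x)\<^sup>2 *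
        (\<Sum>j<N. poly f (X (cos x) j) * chebU m (poly g (X (cos x) j)) / ?d j) = ?h x"
      unfolding residue_sum[OF t f] by (simp add: right_diff_distrib sum_distrib_left mult_ac)
  qed
  also have "integral {0<..<pi} ?h = ?k * (if m = 0 then 1 else 0) - (\<Sum>j=1..N - 1.
     poly f (z j) / poly (pderiv p) (z j) * poissonI (poly g (z j)) m)"
  proof (intro integral_unique has_integral_diff has_integral_sum has_integral_mult_right)
    show "((\<lambda>x. 2 / pi * (sin x)\<^sup>2 * chebU m (cos x)) has_integral (if m = 0 then 1 else 0)) {0<..<pi}"
      unfolding sin_sq_chebU_integral[of m, symmetric]
      by (intro integrable_integral set_lebesgue_integral_eq_integral(1) sin_sq_chebU_abs_integrable)
    show "((\<lambda>x. 2 / pi * (sin x)\<^sup>2 * (chebU m (cos x) / (poly g (z j) - cos x))) has_integral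
        poissonI (poly g (z j)) m) {0<..<pi}" if "j \<in> {1..N - 1}" for j
    proof -
      have "\<bar>poly g (z j)\<bar> \<ge> 1" using that by (intro g_z_abs) auto
      thus ?thesis unfolding poissonI_def
        by (intro integrable_integral set_lebesgue_integral_eq_integral(1) poisson_abs_integrable)
    qed
  qed auto
  finally show ?thesis by simp
qed

section \<open>Closed gaps\<close>

lemma in_some_interval:
  assumes "z 0 < x" "x < z n" "n \<le> N" "x \<notin> z ` {..N}"
  shows "\<exists>j<n. z j < x \<and> x < z (Suc j)"
  using assms
proof (induction n)
  case (Suc n)
  have "x \<noteq> z n" using Suc.prems by auto
  thus ?case using Suc by (cases "x < z n") (auto intro: less_SucI)
qed simp

text \<open>Otherwise \<open>g\<close> would attain a value in \<open>(-1,1)\<close> twice between consecutive nodes, once on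
  either side of its local extremum.\<close>

lemma p_zero_at_closed_gap:
  assumes e: "e > 0" and near: "\<And>x. x \<noteq> \<xi> \<Longrightarrow> \<bar>x - \<xi>\<bar> < e \<Longrightarrow> \<bar>poly g x\<bar> < 1"
    and \<xi>: "\<bar>poly g \<xi>\<bar> = 1"
  shows "poly p \<xi> = 0"
proof (rule ccontr)
  assume np: "poly p \<xi> \<noteq> 0"
  have bd: "z 0 < x \<and> x < z N" if "x \<noteq> \<xi>" "\<bar>x - \<xi>\<bar> < e" for x
  proof -
    have "x \<in> B" using near[OF that] by (simp add: B_def)
    then obtain j where "j < N" "x \<in> branch j" by (auto simp: B_eq)
    thus ?thesis using z_le[of 0 j] z_le[of "Suc j" N] by (auto simp: branch_def)
  qed
  have in0: "z 0 < \<xi>" "\<xi> < z N"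
    using bd[of "\<xi> - e / 2"] bd[of "\<xi> + e / 2"] e by auto
  have "\<xi> \<notin> z ` {..N}"
  proof
    assume "\<xi> \<in> z ` {..N}"
    then obtain j where "j \<le> N" "\<xi> = z j" by auto
    thus False using in0 np p_z[of j] by (cases "j = 0 \<or> j = N") auto
  qed
  then obtain j where j: "j < N" "z j < \<xi>" "\<xi> < z (Suc j)"
    using in_some_interval[OF in0] by auto
  \<comment> \<open>Half the minimum keeps \<open>\<xi> - d\<close> and \<open>\<xi> + d\<close>
    inside both the given neighbourhood and the interval between the nodes.\<close>
  define d where "d = min e (min (\<xi> - z j) (z (Suc j) - \<xi>)) / 2"
  have d: "d > 0" "d < e" "d < \<xi> - z j" "d < z (Suc j) - \<xi>"
    using e j by (auto simp: d_def)
  define s where "s = poly g \<xi>"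
  have s: "s * s = 1" "\<bar>s\<bar> = 1" using \<xi> by (auto simp: s_def abs_if split: if_splits)
  \<comment> \<open>After multiplication by the sign \<open>s\<close> the point \<open>\<xi>\<close>
    is a peak of height \<open>1\<close>. The larger of the two side values is a level below the
    peak that is reached on both sides.\<close>
  define \<tau> where "\<tau> = max (s * poly g (\<xi> - d)) (s * poly g (\<xi> + d))"
  have "\<bar>s * poly g (\<xi> - d)\<bar> < 1" "\<bar>s * poly g (\<xi> + d)\<bar> < 1"
    using near[of "\<xi> - d"] near[of "\<xi> + d"] d s(2) by (auto simp: abs_mult)
  hence \<tau>: "\<bar>\<tau>\<bar> < 1" by (auto simp: \<tau>_def)
  have \<tau>_bd: "s * poly g (\<xi> - d) \<le> \<tau>" "s * poly g (\<xi> + d) \<le> \<tau>" "\<tau> \<le> s * poly g \<xi>"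
    using \<tau> s(1) by (simp add: \<tau>_def, simp add: \<tau>_def, simp add: s_def)
  have cont: "continuous_on S (\<lambda>x. s * poly g x)" for S by (intro continuous_intros)
  obtain u where u: "\<xi> - d \<le> u" "u \<le> \<xi>" "s * poly g u = \<tau>"
    using IVT'[of "\<lambda>x. s * poly g x" "\<xi> - d" \<tau> \<xi>] \<tau>_bd d(1) cont by auto
  obtain v where v: "\<xi> \<le> v" "v \<le> \<xi> + d" "s * poly g v = \<tau>"
    using IVT2'[of "\<lambda>x. s * poly g x" "\<xi> + d" \<tau> \<xi>] \<tau>_bd d(1) cont by auto
  have gu: "poly g u = s * \<tau>" and gv: "poly g v = s * \<tau>"
    using s(1) u(3) v(3) by (metis mult.assoc mult_1)+
  have "\<bar>s * \<tau>\<bar> < 1" using \<tau> s(2) by (simp add: abs_mult)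
  hence "u = X (s * \<tau>) j" "v = X (s * \<tau>) j"
    using root_in_interval[of u j] root_in_interval[of v j] gu gv u v d j(1) by auto
  hence "\<xi> = u" using u v by auto
  thus False using u(3) s(1) \<tau> by (simp add: s_def)
qed

end

section \<open>Moments\<close>

text \<open>The general solution in terms of its two initial values; starting at index
  \<open>j + 2\<close> avoids \<open>U_{-1}\<close>.\<close>

lemma chebU_recurrence:
  assumes "\<And>j. u (Suc (Suc j)) = 2 * t * u (Suc j) - u j"
  shows "u (Suc (Suc j)) = chebU (Suc j) t * u (Suc 0) - chebU j t * u 0"
proof (induction j rule: induct_nat_012)
  case (ge2 j)
  show ?case unfolding assms[of "Suc (Suc j)"] ge2 by (simp add: algebra_simps)
qed (simp_all add: assms algebra_simps)

text \<open>Along a residue class modulo \<open>N\<close>, \<open>PN_shift2\<close> is the Chebyshev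
  recurrence at the point \<open>g x\<close>.\<close>

lemma PN_chebU:
  assumes "N \<ge> 1"
  shows "poly (PN N a (r + Suc (Suc j) * N)) x =
    chebU (Suc j) (poly (gN N a) x) * poly (PN N a (r + N)) x
    - chebU j (poly (gN N a) x) * poly (PN N a r) x"
proof -
  have "poly (PN N a (r + Suc (Suc j) * N)) x
    = 2 * poly (gN N a) x * poly (PN N a (r + Suc j * N)) x - poly (PN N a (r + j * N)) x" for j
  proof -
    have e: "r + Suc (Suc j) * N = (r + j * N) + 2 * N" "r + Suc j * N = (r + j * N) + N" by simp_all
    show ?thesis unfolding e PN_shift2[OF assms] by simp
  qed
  from chebU_recurrence[of "\<lambda>j. poly (PN N a (r + j * N)) x", OF this] show ?thesis by simp
qed

text \<open>In the residue class of \<open>N - 1\<close> the initial values are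
  \<open>P_{N-1}\<close> times \<open>U_0\<close> and \<open>U_1\<close> at \<open>g\<close>, so a
  single Chebyshev term remains.\<close>

lemma PN_chebU_last:
  assumes "N \<ge> 1"
  shows "poly (PN N a (N - 1 + j * N)) x = chebU j (poly (gN N a) x) * poly (PN N a (N - 1)) x"
proof -
  have 1: "poly (PN N a (N - 1 + N)) x = 2 * poly (gN N a) x * poly (PN N a (N - 1)) x"
    using PN_2N_minus_1[OF assms, of a] by simp
  consider "j = 0" | "j = 1" | i where "j = Suc (Suc i)" by (metis One_nat_def not0_implies_Suc)
  thus ?thesis
  proof cases
    case 2
    thus ?thesis using 1 by simp
  next
    case 3
    show ?thesis unfolding 3 PN_chebU[OF assms] 1 by (simp add: algebra_simps)
  qed simp
qed

lemma poly_far_left: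
  fixes q :: "real poly"
  assumes "lead_coeff q > 0"
  shows "\<exists>n. \<forall>x\<ge>n. (-1) ^ degree q * poly q (- x) \<ge> lead_coeff q"
proof -
  let ?q = "smult ((-1) ^ degree q) (q \<circ>\<^sub>p [:0, -1:])"
  have lc: "lead_coeff ?q = lead_coeff q"
    using lead_coeff_comp[of "[:0, -1 :: real:]" q] by (simp flip: power_mult_distrib)
  obtain n where "\<forall>x\<ge>n. poly ?q x \<ge> lead_coeff ?q"
    using poly_pinfty_gt_lc[of ?q] lc assms by auto
  thus ?thesis unfolding lc by (auto simp: poly_pcompose)
qed

locale periodic_jacobi =
  fixes N :: nat and a :: real and y :: "nat \<Rightarrow> real"
  assumes N1: "N \<ge> 1"
    and y_zeros: "y ` {1..N - 1} = {x. poly (PN N a (N - 1)) x = 0}"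
    and y_mono: "strict_mono_on {1..N - 1} y"
begin

abbreviation "P \<equiv> PN N a"
abbreviation "Q \<equiv> QN N a"
abbreviation "g \<equiv> gN N a"
abbreviation "p \<equiv> PN N a (N - 1)"
abbreviation "lam k \<equiv> poly (PN N a N) (y k)"
abbreviation "p' k \<equiv> poly (pderiv (PN N a (N - 1))) (y k)"

section \<open>The zeros of \<open>P_{N-1}\<close> as interlacing nodes\<close>

lemma p_y: "k \<in> {1..N - 1} \<Longrightarrow> poly p (y k) = 0"
  using y_zeros by blast

lemma at_y:
  assumes "k \<in> {1..N - 1}"
  shows "lam k \<noteq> 0" "poly (Q (N - 1)) (y k) = - inverse (lam k)"
    "poly g (y k) = (lam k + inverse (lam k)) / 2" "lam k * p' k < 0"
    "poly (P (n + N)) (y k) = lam k * poly (P n) (y k)"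
  using at_zero_of_PN[OF N1 p_y[OF assms]] by auto

lemma y_inj: "inj_on y {1..N - 1}"
  using y_mono by (rule strict_mono_on_imp_inj_on)

lemma y_less: "1 \<le> i \<Longrightarrow> i < j \<Longrightarrow> j \<le> N - 1 \<Longrightarrow> y i < y j"
  using y_mono by (auto simp: strict_mono_on_def)

text \<open>In the product formula for the derivative exactly the \<open>N - 1 - j\<close> zeros to
  the right of \<open>y j\<close> give negative factors.\<close>

lemma p'_sign:
  assumes j: "j \<in> {1..N - 1}"
  shows "(-1) ^ (N - 1 - j) * p' j > 0"
proof -
  have "p = smult (lead_coeff p) (\<Prod>r\<in>y ` {1..N - 1}. [:-r, 1:])"
    using y_inj p_y by (intro poly_eq_prod_linear) (auto simp: card_image)
  hence "p' j = 2 ^ (N - 1) * poly (pderiv (\<Prod>r\<in>y ` {1..N - 1}. [:-r, 1:])) (y j)"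
    by (metis coeff_PN_self degree_PN_eq pderiv_smult poly_smult)
  also have "poly (pderiv (\<Prod>r\<in>y ` {1..N - 1}. [:-r, 1:])) (y j) = (\<Prod>s\<in>y ` {1..N - 1} - {y j}. y j - s)"
    using j by (intro pderiv_prod_linear_at_root) auto
  also have "y ` {1..N - 1} - {y j} = y ` ({1..N - 1} - {j})"
    using y_inj j by (auto simp: inj_on_def)
  also have "(\<Prod>s\<in>y ` ({1..N - 1} - {j}). y j - s) = (\<Prod>i\<in>{1..N - 1} - {j}. y j - y i)"
    using inj_on_subset[OF y_inj] by (subst prod.reindex) auto
  also have "{1..N - 1} - {j} = {1..<j} \<union> {j<..N - 1}" using j by auto
  also have "(\<Prod>i\<in>{1..<j} \<union> {j<..N - 1}. y j - y i) = (\<Prod>i\<in>{1..<j}. y j - y i) * (\<Prod>i\<in>{j<..N - 1}. -1 * (y i - y j))"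
    by (subst prod.union_disjoint) auto
  also have "(\<Prod>i\<in>{j<..N - 1}. -1 * (y i - y j)) = (-1) ^ (N - 1 - j) * (\<Prod>i\<in>{j<..N - 1}. y i - y j)"
    by (subst prod.distrib) simp
  finally have e: "p' j = 2 ^ (N - 1) * ((\<Prod>i\<in>{1..<j}. y j - y i) *
      ((-1) ^ (N - 1 - j) * (\<Prod>i\<in>{j<..N - 1}. y i - y j)))" .
  have s: "(-1) ^ (N - 1 - j) * (-1) ^ (N - 1 - j) = (1 :: real)" by (simp flip: power_mult_distrib)
  have "(-1) ^ (N - 1 - j) * p' j = ((-1) ^ (N - 1 - j) * (-1) ^ (N - 1 - j)) *
      (2 ^ (N - 1) * ((\<Prod>i\<in>{1..<j}. y j - y i) * (\<Prod>i\<in>{j<..N - 1}. y i - y j)))"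
    unfolding e by (simp only: mult_ac)
  also have "\<dots> > 0"
    unfolding s using j y_less by (auto intro!: mult_pos_pos prod_pos)
  finally show ?thesis .
qed

text \<open>\<open>g (y j)\<close> has the sign of \<open>lam j\<close>, which is opposite to that
  of \<open>p' j\<close>; its modulus is at least \<open>1\<close> as a Joukowski value.\<close>

lemma g_y_sign:
  assumes j: "j \<in> {1..N - 1}"
  shows "(-1) ^ (N - j) * poly g (y j) \<ge> 1"
proof -
  have ev: "N - j = Suc (N - 1 - j)" using j by auto
  have l: "(-1) ^ (N - j) * lam j > 0"
    using p'_sign[OF j] at_y(4)[OF j] unfolding ev
    by (cases "even (N - 1 - j)") (auto simp: mult_less_0_iff)
  have "\<bar>poly g (y j)\<bar> \<ge> 1"
    unfolding at_y(3)[OF j] by (rule abs_joukowski_ge(1)[OF at_y(1)[OF j]])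
  moreover have "(-1) ^ (N - j) * poly g (y j) > 0"
  proof -
    have "(-1) ^ (N - j) * inverse (lam j) > 0" using l by (cases "even (N - j)") auto
    thus ?thesis unfolding at_y(3)[OF j] using l by (simp add: distrib_left add_pos_pos)
  qed
  ultimately show ?thesis by (cases "even (N - j)") auto
qed

text \<open>Provides the two outer nodes: far out, \<open>g\<close> exceeds its leading coefficient
  \<open>2 ^ (N - 1) \<ge> 1\<close> in modulus, with the sign given by the parity of
  \<open>N\<close> on the left.\<close>

lemma far_ex: "\<exists>M>0. (\<forall>k\<in>{1..N - 1}. \<bar>y k\<bar> < M) \<and> poly g M \<ge> 1 \<and> (-1) ^ N * poly g (- M) \<ge> 1"
proof -
  have lc: "lead_coeff g \<ge> 1" "lead_coeff g > 0" unfolding degree_gN(2)[OF N1] by auto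
  obtain n1 where n1: "\<forall>x\<ge>n1. poly g x \<ge> lead_coeff g" using poly_pinfty_gt_lc[OF lc(2)] by blast
  obtain n2 where n2: "\<forall>x\<ge>n2. (-1) ^ degree g * poly g (- x) \<ge> lead_coeff g"
    using poly_far_left[OF lc(2)] by blast
  define M where "M = Max (insert 0 ((\<lambda>k. \<bar>y k\<bar>) ` {1..N - 1})) + 1 + \<bar>n1\<bar> + \<bar>n2\<bar>"
  have "\<bar>y k\<bar> < M" if "k \<in> {1..N - 1}" for k
  proof -
    have "\<bar>y k\<bar> \<le> Max (insert 0 ((\<lambda>k. \<bar>y k\<bar>) ` {1..N - 1}))" using that by (intro Max_ge) auto
    thus ?thesis by (simp add: M_def)
  qed
  moreover have M0: "M > 0" "M \<ge> n1" "M \<ge> n2"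
  proof -
    have "0 \<le> Max (insert 0 ((\<lambda>k. \<bar>y k\<bar>) ` {1..N - 1}))" by (intro Max_ge) auto
    thus "M > 0" "M \<ge> n1" "M \<ge> n2" unfolding M_def by linarith+
  qed
  moreover have "poly g M \<ge> 1" "(-1) ^ N * poly g (- M) \<ge> 1"
    using n1 n2 M0 lc(1) degree_gN(1)[OF N1, of a] by (auto intro: order.trans)
  ultimately show ?thesis by blast
qed

definition far :: real where
  "far = (SOME M. M > 0 \<and> (\<forall>k\<in>{1..N - 1}. \<bar>y k\<bar> < M) \<and> poly g M \<ge> 1 \<and> (-1) ^ N * poly g (- M) \<ge> 1)"

lemma far: "far > 0" "\<And>k. k \<in> {1..N - 1} \<Longrightarrow> \<bar>y k\<bar> < far" "poly g far \<ge> 1" "(-1) ^ N * poly g (- far) \<ge> 1"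
  using someI_ex[OF far_ex] unfolding far_def by auto

definition node :: "nat \<Rightarrow> real" where
  "node j = (if j = 0 then - far else if j = N then far else y j)"

sublocale interlacing N "PN N a (N - 1)" "gN N a" node
proof
  show "strict_mono_on {0..N} node"
  proof (rule strict_mono_onI)
    fix i j assume ij: "i \<in> {0..N}" "j \<in> {0..N}" "i < j"
    have y_far: "- far < y k" "y k < far" if "0 < k" "k < N" for k
    proof -
      have "k \<in> {1..N - 1}" using that by auto
      from far(2)[OF this] show "- far < y k" "y k < far" by linarith+
    qed
    show "node i < node j"
      using far(1) y_far[of i] y_far[of j] y_less[of i j] ij
      by (cases "i = 0"; cases "j = N") (auto simp: node_def)
  qed
  show "(-1) ^ (N - j) * poly (gN N a) (node j) \<ge> 1" if "j \<le> N" for j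
    using g_y_sign[of j] far(3,4) that N1 by (cases "j = 0"; cases "j = N") (auto simp: node_def)
qed (use N1 p_y degree_gN[OF N1] in \<open>auto simp: node_def\<close>)

lemma node_y: "k \<in> {1..N - 1} \<Longrightarrow> node k = y k"
  by (auto simp: node_def)

section \<open>The moment functional\<close>

lemma \<omega>_eq: "\<omega> = weight N a"
  by (rule ext) (unfold \<omega>_def weight_def, rule refl)

text \<open>Integration against \<open>mu\<close>, with the gauge integral on the continuous part;
  it is identified with the Bochner integral once all moments are known.\<close>

definition L :: "(real \<Rightarrow> real) \<Rightarrow> real" where
  "L F = integral B (\<lambda>x. F x * \<omega> x) + (\<Sum>k=1..N - 1. mass N a (y k) * F (y k))"

lemma L_add:
  assumes "continuous_on UNIV F" "continuous_on UNIV G"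
  shows "L (\<lambda>x. F x + G x) = L F + L G"
proof -
  have "integral B (\<lambda>x. F x * \<omega> x + G x * \<omega> x) = integral B (\<lambda>x. F x * \<omega> x) + integral B (\<lambda>x. G x * \<omega> x)"
    by (intro integral_add set_lebesgue_integral_eq_integral(1) B_integral(1) assms)
  thus ?thesis by (simp add: L_def algebra_simps sum.distrib)
qed

lemma L_scale: "L (\<lambda>x. c * F x) = c * L F"
  by (simp add: L_def algebra_simps sum_distrib_left)

lemma L_diff:
  assumes "continuous_on UNIV F" "continuous_on UNIV G"
  shows "L (\<lambda>x. F x - G x) = L F - L G"
  using L_add[OF assms(1), of "\<lambda>x. -1 * G x"] L_scale[of "-1" G] assms(2)
  by (simp add: continuous_on_minus)

text \<open>Removes the absolute values: \<open>g^2 - 1\<close> is the square of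
  \<open>(lam - 1/lam) / 2\<close>, and for \<open>\<bar>lam\<bar> < 1\<close> both
  \<open>lam - 1/lam\<close> and \<open>p'\<close> have the sign opposite to
  \<open>lam\<close>.\<close>

lemma mass_y:
  assumes k: "k \<in> {1..N - 1}"
  shows "mass N a (y k) = (if \<bar>lam k\<bar> < 1 then 2 * (lam k - inverse (lam k)) else 0) / p' k"
proof (cases "\<bar>lam k\<bar> < 1")
  case True
  let ?l = "lam k"
  have l: "?l \<noteq> 0" by (rule at_y(1)[OF k])
  have "(poly g (y k))\<^sup>2 - 1 = ((?l - inverse ?l) / 2)\<^sup>2"
    unfolding at_y(3)[OF k] using l by (simp add: field_simps power2_eq_square)
  hence s: "sqrt \<bar>(poly g (y k))\<^sup>2 - 1\<bar> = \<bar>?l - inverse ?l\<bar> / 2" by simp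
  have "?l\<^sup>2 < 1" using True by (simp add: abs_square_less_1)
  hence "?l * (?l - inverse ?l) < 0" using l by (simp add: right_diff_distrib power2_eq_square)
  hence "(?l - inverse ?l) / p' k > 0"
    using at_y(4)[OF k] by (auto simp: mult_less_0_iff zero_less_divide_iff)
  hence q: "\<bar>?l - inverse ?l\<bar> / \<bar>p' k\<bar> = (?l - inverse ?l) / p' k"
    unfolding abs_divide[symmetric] by (rule abs_of_pos)
  have "mass N a (y k) = 2 * (\<bar>?l - inverse ?l\<bar> / \<bar>p' k\<bar>)"
    using True by (simp add: mass_def s)
  thus ?thesis unfolding q using True by simp
next
  case False
  thus ?thesis by (simp add: mass_def)
qed

text \<open>By \<open>poissonI_eq_residue\<close> the point mass at \<open>y k\<close> combines with
  the Poisson integral into a power of \<open>1 / lam k\<close>, whatever the size of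
  \<open>lam k\<close>.\<close>

lemma L_chebU:
  assumes f: "degree f \<le> 2 * N - 2"
  shows "L (\<lambda>x. poly f x * chebU m (poly g x)) =
    (if m = 0 then coeff f (2 * N - 2) / 4 ^ (N - 1) else 0) -
    (\<Sum>k=1..N - 1. poly f (y k) / p' k * (2 * inverse (lam k) ^ Suc m))"
proof -
  have "(\<Sum>k=1..N - 1. mass N a (y k) * (poly f (y k) * chebU m (poly g (y k)))) =
    (\<Sum>k=1..N - 1. poly f (y k) / p' k *
      (if \<bar>lam k\<bar> < 1 then 2 * (lam k - inverse (lam k)) * chebU m (poly g (y k)) else 0))"
    by (intro sum.cong) (auto simp: mass_y)
  moreover have "(\<Sum>k=1..N - 1. poly f (node k) / poly (pderiv p) (node k) * poissonI (poly g (node k)) m)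
      = (\<Sum>k=1..N - 1. poly f (y k) / p' k * poissonI (poly g (y k)) m)"
    by (intro sum.cong) (auto simp: node_y)
  moreover have "lead_coeff p * lead_coeff g = 4 ^ (N - 1)"
    unfolding degree_gN(2)[OF N1] by (simp flip: power_mult_distrib)
  ultimately have "L (\<lambda>x. poly f x * chebU m (poly g x)) =
    (if m = 0 then coeff f (2 * N - 2) / 4 ^ (N - 1) else 0) -
    ((\<Sum>k=1..N - 1. poly f (y k) / p' k * poissonI (poly g (y k)) m)
     - (\<Sum>k=1..N - 1. poly f (y k) / p' k *
      (if \<bar>lam k\<bar> < 1 then 2 * (lam k - inverse (lam k)) * chebU m (poly g (y k)) else 0)))"
    unfolding L_def B_integral_chebU[OF f] by simp
  also have "(\<Sum>k=1..N - 1. poly f (y k) / p' k * poissonI (poly g (y k)) m)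
     - (\<Sum>k=1..N - 1. poly f (y k) / p' k *
      (if \<bar>lam k\<bar> < 1 then 2 * (lam k - inverse (lam k)) * chebU m (poly g (y k)) else 0))
    = (\<Sum>k=1..N - 1. poly f (y k) / p' k * (2 * inverse (lam k) ^ Suc m))"
    unfolding sum_subtractf[symmetric] right_diff_distrib[symmetric]
  proof (intro sum.cong refl)
    fix k assume "k \<in> {1..N - 1}"
    from poissonI_eq_residue[OF at_y(1)[OF this], of m, folded at_y(3)[OF this]]
    show "poly f (y k) / p' k * (poissonI (poly g (y k)) m -
        (if \<bar>lam k\<bar> < 1 then 2 * (lam k - inverse (lam k)) * chebU m (poly g (y k)) else 0))
      = poly f (y k) / p' k * (2 * inverse (lam k) ^ Suc m)" by (simp only:)
  qed
  finally show ?thesis .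
qed

lemma sum_over_y:
  assumes "degree f \<le> N - 2" "N \<ge> 2"
  shows "(\<Sum>k=1..N - 1. poly f (y k) / p' k) = coeff f (N - 2) / 2 ^ (N - 1)"
proof -
  let ?Y = "y ` {1..N - 1}"
  have card: "card ?Y = N - 1" using y_inj by (simp add: card_image)
  have "(\<Sum>r\<in>?Y. poly f r / poly (pderiv p) r) = coeff f (card ?Y - 1) / lead_coeff p"
    using assms card p_y by (intro sum_over_simple_roots) auto
  thus ?thesis unfolding card sum.reindex[OF y_inj] o_def by (simp add: numeral_2_eq_2)
qed

text \<open>Write \<open>n = r + j N\<close> and expand \<open>P_n\<close> in Chebyshev polynomials
  of \<open>g\<close>. \<open>L_chebU\<close> leaves sums over the zeros, where
  \<open>P_{r+N} = lam P_r\<close> cancels one power of \<open>1 / lam\<close>.\<close>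

lemma L_P: "L (poly (P n)) = (if n = 0 then 1 else 0)"
proof -
  define r j where "r = n mod N" and "j = n div N"
  have n: "n = r + j * N" and r: "r < N" using N1 by (auto simp: r_def j_def)
  show ?thesis
  proof (cases "r = N - 1")
    case True
    have "poly (P n) = (\<lambda>x. poly p x * chebU j (poly g x))"
      unfolding n True PN_chebU_last[OF N1] by (simp add: fun_eq_iff)
    hence "L (poly (P n)) = (if j = 0 then coeff p (2 * N - 2) / 4 ^ (N - 1) else 0)"
      using N1 p_y by (simp add: L_chebU)
    \<comment> \<open>Here \<open>p\<close> vanishes at all \<open>y k\<close>, so only the term at
      infinity is left; the degree \<open>N - 1\<close> equals \<open>2 N - 2\<close> just for
      \<open>N = 1\<close>.\<close>
    moreover have "coeff p (2 * N - 2) = (if N = 1 then 1 else 0)"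
      using N1 by (auto intro: coeff_eq_0)
    ultimately show ?thesis using n True N1 by (cases j) auto
  next
    case False
    hence r: "r \<le> N - 2" and N2: "N \<ge> 2" using r by auto
    have c0: "coeff (P r) (2 * N - 2) = 0" using r N2 by (intro coeff_eq_0) simp
    consider "j = 0" | "j = 1" | i where "j = Suc (Suc i)" by (metis One_nat_def not0_implies_Suc)
    thus ?thesis
    proof cases
      case 1
      \<comment> \<open>At \<open>y k\<close> this polynomial equals \<open>- P_r / lam\<close>,
        because \<open>Q_{N-1} = - 1 / lam\<close> there. Its degree is at most
        \<open>N - 2 - r\<close>, so the sum over the zeros is nonzero only for
        \<open>r = 0\<close>, when \<open>?R\<close> is \<open>Q_{N-1}\<close>.\<close>
      let ?R = "P r * Q (N - 1) - P (N - 1) * Q r"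
      have e: "r + 1 + (N - 2 - r) = N - 1" using r N2 by auto
      have degR: "degree ?R \<le> N - 2 - r" using degree_casorati_le[of N a r "N - 2 - r"] unfolding e .
      have "L (poly (P n)) = L (\<lambda>x. poly (P r) x * chebU 0 (poly g x))" using n 1 by simp
      also have "\<dots> = - (\<Sum>k=1..N - 1. poly (P r) (y k) / p' k * (2 * inverse (lam k)))"
        using r N2 c0 by (subst L_chebU) auto
      also have "\<dots> = 2 * (\<Sum>k=1..N - 1. poly ?R (y k) / p' k)"
        unfolding sum_negf[symmetric] sum_distrib_left
      proof (intro sum.cong refl)
        fix k assume k: "k \<in> {1..N - 1}"
        show "- (poly (P r) (y k) / p' k * (2 * inverse (lam k))) = 2 * (poly ?R (y k) / p' k)"
          unfolding poly_diff poly_mult p_y[OF k] at_y(2)[OF k] by simp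
      qed
      also have "(\<Sum>k=1..N - 1. poly ?R (y k) / p' k) = coeff ?R (N - 2) / 2 ^ (N - 1)"
        using degR N2 by (intro sum_over_y) auto
      also have "2 * (coeff ?R (N - 2) / 2 ^ (N - 1)) = (if r = 0 then 1 else 0)"
      proof (cases "r = 0")
        case True
        have s: "Suc (N - 2) = N - 1" using N2 by simp
        have "coeff (Q (N - 1)) (N - 2) = 2 ^ (N - 2)" using degree_QN[of N a "N - 2"] unfolding s by simp
        moreover have "(2 :: real) ^ (N - 1) = 2 * 2 ^ (N - 2)" unfolding s[symmetric] by simp
        ultimately show ?thesis using True by simp
      next
        case False
        thus ?thesis using degR r by (subst coeff_eq_0) auto
      qed
      finally show ?thesis using n 1 N1 by simp
    next
      case 2
      have "L (poly (P n)) = L (\<lambda>x. poly (P (r + N)) x * chebU 0 (poly g x))" using n 2 by simp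
      also have "\<dots> = coeff (P (r + N)) (2 * N - 2) / 4 ^ (N - 1)
          - (\<Sum>k=1..N - 1. poly (P (r + N)) (y k) / p' k * (2 * inverse (lam k)))"
        using r N2 by (subst L_chebU) auto
      also have "(\<Sum>k=1..N - 1. poly (P (r + N)) (y k) / p' k * (2 * inverse (lam k)))
          = 2 * (\<Sum>k=1..N - 1. poly (P r) (y k) / p' k)"
        unfolding sum_distrib_left by (intro sum.cong refl) (simp add: at_y(5) at_y(1))
      also have "(\<Sum>k=1..N - 1. poly (P r) (y k) / p' k) = coeff (P r) (N - 2) / 2 ^ (N - 1)"
        using r N2 by (intro sum_over_y) auto
      \<comment> \<open>The term at infinity and the sum over the zeros cancel: both are
        \<open>1\<close> for \<open>r = N - 2\<close> and both vanish for smaller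
        \<open>r\<close>.\<close>
      also have "coeff (P (r + N)) (2 * N - 2) / 4 ^ (N - 1) - 2 * (coeff (P r) (N - 2) / 2 ^ (N - 1)) = 0"
      proof (cases "r = N - 2")
        case True
        have "r + N = 2 * N - 2" using N2 True by auto
        hence c: "coeff (P (r + N)) (2 * N - 2) = 2 ^ (2 * N - 2)" "coeff (P r) (N - 2) = 2 ^ (N - 2)"
          using True by (metis coeff_PN_self)+
        have "(4 :: real) ^ (N - 1) = (2\<^sup>2) ^ (N - 1)" by simp
        also have "\<dots> = 2 ^ (2 * N - 2)" unfolding power_mult[symmetric] by (simp add: diff_mult_distrib2)
        finally have "(4 :: real) ^ (N - 1) = 2 ^ (2 * N - 2)" .
        moreover have "(2 :: real) ^ (N - 1) = 2 * 2 ^ (N - 2)"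
          using N2 by (metis One_nat_def Suc_1 Suc_diff_Suc Suc_le_lessD power_Suc)
        ultimately show ?thesis unfolding c by simp
      next
        case False
        have "coeff (P (r + N)) (2 * N - 2) = 0" "coeff (P r) (N - 2) = 0"
          using False r N2 by (auto intro!: coeff_eq_0)
        thus ?thesis by simp
      qed
      finally show ?thesis using n 2 N1 by simp
    next
      case 3
      have "poly (P n) = (\<lambda>x. poly (P (r + N)) x * chebU (Suc i) (poly g x)
          - poly (P r) x * chebU i (poly g x))"
        unfolding n 3 PN_chebU[OF N1] by (simp add: fun_eq_iff mult.commute)
      hence "L (poly (P n)) = L (\<lambda>x. poly (P (r + N)) x * chebU (Suc i) (poly g x))
          - L (\<lambda>x. poly (P r) x * chebU i (poly g x))"
        by (simp only:) (intro L_diff continuous_intros)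
      also have "L (\<lambda>x. poly (P (r + N)) x * chebU (Suc i) (poly g x))
          = - (\<Sum>k=1..N - 1. poly (P (r + N)) (y k) / p' k * (2 * inverse (lam k) ^ Suc (Suc i)))"
        using r N2 by (subst L_chebU) auto
      also have "L (\<lambda>x. poly (P r) x * chebU i (poly g x))
          = - (\<Sum>k=1..N - 1. poly (P r) (y k) / p' k * (2 * inverse (lam k) ^ Suc i))"
        using r N2 c0 by (subst L_chebU) auto
      \<comment> \<open>The factor \<open>lam k\<close> lowers the exponent by one, so the two
        Chebyshev terms contribute the same sum and cancel.\<close>
      also have "(\<Sum>k=1..N - 1. poly (P (r + N)) (y k) / p' k * (2 * inverse (lam k) ^ Suc (Suc i)))
          = (\<Sum>k=1..N - 1. poly (P r) (y k) / p' k * (2 * inverse (lam k) ^ Suc i))"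
        by (intro sum.cong refl) (simp add: at_y(5) at_y(1))
      finally show ?thesis using n 3 N1 by simp
    qed
  qed
qed

lemma two_x_P: "[:0, 2:] * P n = P (Suc n) + smult (rec_coeff N a n) (P n) + (if n = 0 then 0 else P (n - 1))"
  by (cases n) (simp_all add: rec_coeff_0)

text \<open>Multiplication by \<open>2x\<close> can be moved from one factor to the other. Expanding
  it on both sides expresses \<open>P_{i+1} P_n\<close> through products with \<open>P_i\<close> and
  \<open>P_{i-1}\<close>, and the diagonal terms cancel because they survive only for
  \<open>i = n\<close>.\<close>

lemma L_P_P: "L (poly (P m * P n)) = (if m = n then 1 else 0)"
proof -
  define Lp where "Lp q = L (poly q)" for q
  have add: "Lp (q1 + q2) = Lp q1 + Lp q2" for q1 q2
  proof -
    have "poly (q1 + q2) = (\<lambda>x. poly q1 x + poly q2 x)" by (simp add: fun_eq_iff)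
    thus ?thesis unfolding Lp_def by (simp only:) (intro L_add continuous_intros)
  qed
  have scale: "Lp (smult c q) = c * Lp q" for c q
  proof -
    have "poly (smult c q) = (\<lambda>x. c * poly q x)" by (simp add: fun_eq_iff)
    thus ?thesis unfolding Lp_def by (simp only: L_scale)
  qed
  \<comment> \<open>The convention \<open>P_{-1} = 0\<close>, needed as \<open>n - 1\<close> is
    truncated at \<open>0\<close>.\<close>
  define pr where "pr = (\<lambda>n. if n = 0 then 0 else P (n - 1))"
  let ?b = "rec_coeff N a"
  have tx: "[:0, 2:] * P n = P (Suc n) + smult (?b n) (P n) + pr n" for n
    unfolding pr_def by (rule two_x_P)
  have "Lp (P m * P n) = (if m = n then 1 else 0)"
  proof (induction m arbitrary: n rule: less_induct)
    case (less m)
    show ?case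
    proof (cases m)
      case 0
      thus ?thesis using L_P[of n] by (simp add: Lp_def)
    next
      case (Suc i)
      have "P (Suc i) * P n + (smult (?b i) (P i * P n) + pr i * P n)
          = (P (Suc i) + smult (?b i) (P i) + pr i) * P n"
        by (simp only: distrib_right mult_smult_left add.assoc)
      also have "\<dots> = P i * ([:0, 2:] * P n)"
        unfolding tx[symmetric] by (simp only: mult_ac)
      also have "\<dots> = P i * P (Suc n) + (smult (?b n) (P i * P n) + P i * pr n)"
        unfolding tx by (simp only: distrib_left mult_smult_right add.assoc)
      finally have "Lp (P (Suc i) * P n) + (?b i * Lp (P i * P n) + Lp (pr i * P n))
          = Lp (P i * P (Suc n)) + (?b n * Lp (P i * P n) + Lp (P i * pr n))"
        by (simp only: add[symmetric] scale[symmetric])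
      moreover have "Lp 0 = 0" using scale[of 0 0] by simp
      moreover have "Lp (P i * P k) = (if i = k then 1 else 0)" for k using less Suc by simp
      moreover have "Lp (P (i - 1) * P n) = (if i - 1 = n then 1 else 0)" using less Suc by simp
      ultimately show ?thesis using Suc by (auto simp: pr_def split: if_splits)
    qed
  qed
  thus ?thesis by (simp add: Lp_def)
qed

end

section \<open>The measure\<close>

lemma proots_prod_dvd:
  fixes q :: "real poly"
  assumes "q \<noteq> 0"
  shows "(\<Prod>x\<in>#proots q. [:-x, 1:]) dvd q"
  using assms
proof (induction "degree q" arbitrary: q rule: less_induct)
  case (less q)
  show ?case
  proof (cases "\<exists>x. poly q x = 0")
    case False
    hence "proots q = {#}" using less.prems by (auto simp flip: set_mset_eq_empty_iff)
    thus ?thesis by simp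
  next
    case True
    then obtain x q' where q: "q = [:-x, 1:] * q'" by (auto simp: poly_eq_0_iff_dvd dvd_def)
    have q'0: "q' \<noteq> 0" using less.prems q by auto
    have "degree q' < degree q" unfolding q using q'0 by (subst degree_mult_eq) auto
    from less.hyps[OF this q'0] have "(\<Prod>x\<in>#proots q'. [:-x, 1:]) dvd q'" .
    moreover have "proots q = add_mset x (proots q')"
      unfolding q using q'0 by (subst proots_mult) auto
    ultimately show ?thesis unfolding q by (simp add: mult_dvd_mono del: mult_pCons_left)
  qed
qed

text \<open>In general the product over the real roots only divides \<open>q\<close>; when the
  number of roots equals the degree, the cofactor is constant.\<close>

lemma poly_eq_prod_proots:
  fixes q :: "real poly" and \<xi> :: "'i \<Rightarrow> real"
  assumes "finite A" "q \<noteq> 0" "proots q = image_mset \<xi> (mset_set A)" "degree q = card A"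
  shows "poly q x = lead_coeff q * (\<Prod>i\<in>A. x - \<xi> i)"
proof -
  let ?R = "\<Prod>i\<in>A. [:- \<xi> i, 1:]"
  have "(\<Prod>x\<in>#proots q. [:-x, 1:]) = ?R"
    unfolding assms(3) by (simp add: prod_unfold_prod_mset image_mset.compositionality o_def)
  then obtain r where r: "q = ?R * r" using proots_prod_dvd[OF assms(2)] by (auto simp: dvd_def)
  have R: "degree ?R = card A" by (subst degree_prod_eq_sum_degree) auto
  have lR: "lead_coeff ?R = 1" unfolding lead_coeff_prod by simp
  have nz: "r \<noteq> 0" "?R \<noteq> 0" using r assms(2) by auto
  have "degree r = 0" using assms(4) R nz unfolding r by (simp add: degree_mult_eq)
  then obtain c where c: "r = [:c:]" by (auto elim: degree_eq_zeroE)
  have "lead_coeff q = c" unfolding r lead_coeff_mult lR c by simp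
  thus ?thesis by (subst (1) r) (simp add: c poly_prod)
qed

lemma gN_sq_minus_1:
  assumes N: "N \<ge> 1" and roots: "proots ((gN N a)\<^sup>2 - 1) = image_mset \<xi> (mset_set {1..2 * N})"
  shows "(poly (gN N a) x)\<^sup>2 - 1 = 4 ^ (N - 1) * (\<Prod>k=1..N. (x - \<xi> (2 * k - 1)) * (x - \<xi> (2 * k)))"
proof -
  let ?q = "(gN N a)\<^sup>2 - 1"
  have g0: "gN N a \<noteq> 0" using degree_gN(1)[OF N, of a] N by auto
  have d2: "degree ((gN N a)\<^sup>2) = 2 * N"
    using g0 by (simp add: power2_eq_square degree_mult_eq degree_gN(1)[OF N])
  have deg: "degree ?q = 2 * N"
    using N d2 unfolding diff_conv_add_uminus by (subst degree_add_eq_left) auto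
  have "lead_coeff ((gN N a)\<^sup>2) = 4 ^ (N - 1)"
    unfolding lead_coeff_power degree_gN(2)[OF N] by (simp flip: power_mult_distrib add: power2_eq_square)
  hence lc: "lead_coeff ?q = 4 ^ (N - 1)" unfolding deg using d2 N by simp
  have "poly ?q x = lead_coeff ?q * (\<Prod>i\<in>{1..2 * N}. x - \<xi> i)"
    using deg lc roots by (intro poly_eq_prod_proots) auto
  also have "(\<Prod>i\<in>{1..2 * n}. x - \<xi> i) = (\<Prod>k=1..n. (x - \<xi> (2 * k - 1)) * (x - \<xi> (2 * k)))" for n
    by (induction n) (simp_all add: mult_ac)
  finally show ?thesis unfolding lc by simp
qed

text \<open>With the roots of \<open>g^2 - 1\<close> grouped in pairs, a point of a band makes
  exactly its own pair negative, whereas outside the bands no pair is negative.\<close>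

lemma bands_eq:
  assumes N: "N \<ge> 1" and roots: "proots ((gN N a)\<^sup>2 - 1) = image_mset \<xi> (mset_set {1..2 * N})"
    and band: "\<forall>k\<in>{1..N}. \<xi> (2 * k - 1) < \<xi> (2 * k)"
    and gap: "\<forall>k\<in>{1..<N}. \<xi> (2 * k) \<le> \<xi> (2 * k + 1)"
  shows "bands N \<xi> = {x. \<bar>poly (gN N a) x\<bar> < 1}"
    and "i \<in> {1..N} \<Longrightarrow> j \<in> {1..N} \<Longrightarrow> i < j \<Longrightarrow> \<xi> (2 * i) \<le> \<xi> (2 * j - 1)"
proof -
  show mono: "\<xi> (2 * i) \<le> \<xi> (2 * j - 1)" if "i \<in> {1..N}" "j \<in> {1..N}" "i < j" for i j
    using that
  proof (induction j)
    case (Suc j)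
    show ?case
    proof (cases "i = j")
      case True
      thus ?thesis using gap Suc.prems by auto
    next
      case False
      hence "\<xi> (2 * i) \<le> \<xi> (2 * j - 1)" "j \<in> {1..<N}" using Suc by auto
      moreover from this have "\<xi> (2 * j - 1) < \<xi> (2 * j)" "\<xi> (2 * j) \<le> \<xi> (2 * j + 1)"
        using band gap by auto
      ultimately show ?thesis by simp
    qed
  qed simp
  have neg: "\<bar>poly (gN N a) x\<bar> < 1 \<longleftrightarrow> (\<Prod>k=1..N. (x - \<xi> (2 * k - 1)) * (x - \<xi> (2 * k))) < 0" for x
  proof -
    have "\<bar>poly (gN N a) x\<bar> < 1 \<longleftrightarrow> (poly (gN N a) x)\<^sup>2 - 1 < 0" by (simp add: abs_square_less_1)
    thus ?thesis unfolding gN_sq_minus_1[OF N roots] by (simp add: mult_less_0_iff)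
  qed
  show "bands N \<xi> = {x. \<bar>poly (gN N a) x\<bar> < 1}"
  proof (intro equalityI subsetI)
    fix x assume "x \<in> bands N \<xi>"
    then obtain k where k: "k \<in> {1..N}" "\<xi> (2 * k - 1) < x" "x < \<xi> (2 * k)" by (auto simp: bands_def)
    let ?f = "\<lambda>k. (x - \<xi> (2 * k - 1)) * (x - \<xi> (2 * k))"
    have "?f k < 0" using k by (simp add: mult_less_0_iff)
    moreover have "(\<Prod>i\<in>{1..N} - {k}. ?f i) > 0"
    proof (rule prod_pos)
      fix i assume i: "i \<in> {1..N} - {k}"
      show "?f i > 0"
      proof (cases "i < k")
        case True
        hence "\<xi> (2 * i) \<le> \<xi> (2 * k - 1)" "\<xi> (2 * i - 1) < \<xi> (2 * i)" using mono[of i k] band i k by auto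
        thus ?thesis using k by (intro mult_pos_pos) auto
      next
        case False
        hence "\<xi> (2 * k) \<le> \<xi> (2 * i - 1)" "\<xi> (2 * i - 1) < \<xi> (2 * i)" using mono[of k i] band i k by auto
        thus ?thesis using k by (intro mult_neg_neg) auto
      qed
    qed
    ultimately have "(\<Prod>k=1..N. ?f k) < 0"
      using k(1) by (subst prod.remove[of _ k]) (auto intro: mult_neg_pos)
    thus "x \<in> {x. \<bar>poly (gN N a) x\<bar> < 1}" using neg by simp
  next
    fix x assume "x \<in> {x. \<bar>poly (gN N a) x\<bar> < 1}"
    hence "\<not> (\<forall>k\<in>{1..N}. (x - \<xi> (2 * k - 1)) * (x - \<xi> (2 * k)) \<ge> 0)"
      using neg prod_nonneg[of "{1..N}"] by (metis (no_types, lifting) mem_Collect_eq not_less)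
    then obtain k where "k \<in> {1..N}" "(x - \<xi> (2 * k - 1)) * (x - \<xi> (2 * k)) < 0" by force
    moreover from this have "\<xi> (2 * k - 1) < x \<and> x < \<xi> (2 * k)"
      using band by (force simp: mult_less_0_iff)
    ultimately show "x \<in> bands N \<xi>" by (auto simp: bands_def)
  qed
qed

section \<open>Integration with respect to \<open>mu\<close>\<close>

lemma bands_measurable [measurable]: "bands N \<xi> \<in> sets borel"
  unfolding bands_def by auto

lemma weight_measurable [measurable]: "weight N a \<in> borel_measurable borel"
  unfolding weight_def by (intro borel_measurable_divide borel_measurable_times borel_measurable_const
    borel_measurable_continuous_onI continuous_intros)

lemma weight_nonneg: "weight N a x \<ge> 0" and mass_nonneg: "mass N a x \<ge> 0"
  by (simp_all add: weight_def mass_def)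

text \<open>Induction over nonnegative Borel functions: indicators are covered by
  \<open>emeasure_mu\<close>, limits by monotone convergence on both sides.\<close>

lemma nn_integral_mu:
  assumes "f \<in> borel_measurable borel"
  shows "(\<integral>\<^sup>+x. f x \<partial>mu N a \<xi> y) =
    (\<integral>\<^sup>+x. ennreal (indicator (bands N \<xi>) x * weight N a x) * f x \<partial>lborel)
      + (\<Sum>k=1..N - 1. ennreal (mass N a (y k)) * f (y k))"
  (is "?I f = ?J f")
  using assms
proof (induction rule: borel_measurable_induct)
  case (cong f g)
  thus ?case by (simp cong: nn_integral_cong)
next
  case (set A)
  thus ?case by (simp add: emeasure_mu emeasure_density)
next
  case (mult v u)
  have "(\<integral>\<^sup>+x. ennreal (indicator (bands N \<xi>) x * weight N a x) * (u * v x) \<partial>lborel)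
      = u * (\<integral>\<^sup>+x. ennreal (indicator (bands N \<xi>) x * weight N a x) * v x \<partial>lborel)"
    unfolding mult.left_commute[of _ u] using mult by (intro nn_integral_cmult) simp
  moreover have "?I (\<lambda>x. u * v x) = u * ?I v" using mult by (intro nn_integral_cmult) simp
  ultimately show ?case
    by (simp only: mult.IH distrib_left sum_distrib_left mult.left_commute[of _ u])
next
  case (add u v)
  have "(\<integral>\<^sup>+x. ennreal (indicator (bands N \<xi>) x * weight N a x) * (v x + u x) \<partial>lborel)
      = (\<integral>\<^sup>+x. ennreal (indicator (bands N \<xi>) x * weight N a x) * v x \<partial>lborel)
      + (\<integral>\<^sup>+x. ennreal (indicator (bands N \<xi>) x * weight N a x) * u x \<partial>lborel)"
    unfolding distrib_left using add by (intro nn_integral_add) simp_all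
  moreover have "?I (\<lambda>x. v x + u x) = ?I v + ?I u" using add by (intro nn_integral_add) simp_all
  ultimately show ?case
    by (simp only: add.IH distrib_left sum.distrib) (simp only: add_ac)
next
  case (seq U)
  have lim: "(\<lambda>i. U i x) \<longlonglongrightarrow> (SUP i. U i) x" for x
    unfolding SUP_apply using seq(3) by (intro LIMSEQ_SUP) (auto simp: incseq_def le_fun_def)
  have "(\<lambda>i. ?I (U i)) \<longlonglongrightarrow> ?I (SUP i. U i)"
    using seq lim by (intro nn_integral_LIMSEQ) auto
  moreover have "(\<lambda>i. ?J (U i)) \<longlonglongrightarrow> ?J (SUP i. U i)"
  proof (intro tendsto_add tendsto_sum ennreal_tendsto_cmult lim nn_integral_LIMSEQ)
    show "incseq (\<lambda>i x. ennreal (indicator (bands N \<xi>) x * weight N a x) * U i x)"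
      using seq(3) by (auto simp: incseq_def le_fun_def intro!: mult_left_mono)
  qed (use seq(1) in auto)
  ultimately show ?case unfolding seq.IH by (rule LIMSEQ_unique)
qed

text \<open>Positive and negative parts are treated separately by \<open>nn_integral_mu\<close>,
  then subtracted.\<close>

lemma has_bochner_integral_mu:
  fixes f :: "real \<Rightarrow> real"
  assumes f: "f \<in> borel_measurable borel"
    and int: "set_integrable lborel (bands N \<xi>) (\<lambda>x. f x * weight N a x)"
  shows "has_bochner_integral (mu N a \<xi> y) f
    ((LBINT x:bands N \<xi>. f x * weight N a x) + (\<Sum>k=1..N - 1. mass N a (y k) * f (y k)))"
proof -
  have nonneg: "has_bochner_integral (mu N a \<xi> y) h
      ((LBINT x:bands N \<xi>. h x * weight N a x) + (\<Sum>k=1..N - 1. mass N a (y k) * h (y k)))"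
    if h: "h \<in> borel_measurable borel" "\<And>x. h x \<ge> 0"
      "set_integrable lborel (bands N \<xi>) (\<lambda>x. h x * weight N a x)" for h :: "real \<Rightarrow> real"
  proof (rule has_bochner_integral_nn_integral)
    have "(\<integral>\<^sup>+x. ennreal (indicator (bands N \<xi>) x * weight N a x) * ennreal (h x) \<partial>lborel)
        = (\<integral>\<^sup>+x. ennreal (indicator (bands N \<xi>) x *\<^sub>R (h x * weight N a x)) \<partial>lborel)"
      using h(2) weight_nonneg by (intro nn_integral_cong) (simp add: ennreal_mult'' [symmetric] mult_ac)
    also have "\<dots> = ennreal (LBINT x:bands N \<xi>. h x * weight N a x)"
      using h(2,3) weight_nonneg unfolding set_lebesgue_integral_def set_integrable_def
      by (intro nn_integral_eq_integral) auto
    finally have 1: "(\<integral>\<^sup>+x. ennreal (indicator (bands N \<xi>) x * weight N a x) * ennreal (h x) \<partial>lborel)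
        = ennreal (LBINT x:bands N \<xi>. h x * weight N a x)" .
    have "(\<Sum>k=1..N - 1. ennreal (mass N a (y k)) * ennreal (h (y k)))
        = ennreal (\<Sum>k=1..N - 1. mass N a (y k) * h (y k))"
      using h(2) mass_nonneg by (simp add: ennreal_mult'[symmetric] sum_ennreal)
    thus "(\<integral>\<^sup>+x. ennreal (h x) \<partial>mu N a \<xi> y) =
      ennreal ((LBINT x:bands N \<xi>. h x * weight N a x) + (\<Sum>k=1..N - 1. mass N a (y k) * h (y k)))"
      using h 1 weight_nonneg mass_nonneg unfolding set_lebesgue_integral_def
      by (subst nn_integral_mu) (auto simp: ennreal_plus sum_nonneg intro!: ennreal_plus[symmetric])
    show "0 \<le> (LBINT x:bands N \<xi>. h x * weight N a x) + (\<Sum>k=1..N - 1. mass N a (y k) * h (y k))"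
      using h(2) weight_nonneg mass_nonneg unfolding set_lebesgue_integral_def
      by (intro add_nonneg_nonneg sum_nonneg Bochner_Integration.integral_nonneg) auto
  qed (use h in auto)
  let ?p = "\<lambda>x. max 0 (f x)" and ?n = "\<lambda>x. max 0 (- f x)"
  have int': "integrable lborel (\<lambda>x. indicator (bands N \<xi>) x *\<^sub>R (f x * weight N a x))"
    using int by (simp add: set_integrable_def)
  have ip: "set_integrable lborel (bands N \<xi>) (\<lambda>x. ?p x * weight N a x)"
    and im: "set_integrable lborel (bands N \<xi>) (\<lambda>x. ?n x * weight N a x)"
    unfolding set_integrable_def using f weight_nonneg
    by (auto intro!: Bochner_Integration.integrable_bound[OF int'] AE_I2
        simp: abs_mult mult_right_mono mult_nonpos_nonneg max_def split: split_indicator)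
  have "has_bochner_integral (mu N a \<xi> y) (\<lambda>x. ?p x - ?n x)
    (((LBINT x:bands N \<xi>. ?p x * weight N a x) + (\<Sum>k=1..N - 1. mass N a (y k) * ?p (y k)))
    - ((LBINT x:bands N \<xi>. ?n x * weight N a x) + (\<Sum>k=1..N - 1. mass N a (y k) * ?n (y k))))"
    using f ip im by (intro has_bochner_integral_diff nonneg) auto
  moreover have "(\<lambda>x. ?p x - ?n x) = f" by (auto simp: max_def)
  moreover have "(LBINT x:bands N \<xi>. ?p x * weight N a x) - (LBINT x:bands N \<xi>. ?n x * weight N a x)
      = (LBINT x:bands N \<xi>. f x * weight N a x)"
    unfolding set_integral_diff(2)[OF ip im, symmetric]
    by (intro arg_cong[where f = "set_lebesgue_integral lborel _"]) (auto simp: max_def)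
  moreover have "(\<Sum>k=1..N - 1. mass N a (y k) * ?p (y k)) - (\<Sum>k=1..N - 1. mass N a (y k) * ?n (y k))
      = (\<Sum>k=1..N - 1. mass N a (y k) * f (y k))"
    unfolding sum_subtractf[symmetric] by (intro sum.cong) (auto simp: max_def)
  ultimately show ?thesis by (simp add: algebra_simps)
qed

text \<open>Passes from Lebesgue measure, where the gauge integral lives, to \<open>lborel\<close>;
  for a Borel integrand the completion changes nothing.\<close>

lemma (in periodic_jacobi) B_lborel:
  assumes "continuous_on UNIV F"
  shows "set_integrable lborel B (\<lambda>x. F x * weight N a x)"
    and "(LBINT x:B. F x * weight N a x) = integral B (\<lambda>x. F x * \<omega> x)"
proof -
  have [measurable]: "F \<in> borel_measurable borel" using assms by (rule borel_measurable_continuous_onI)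
  have [measurable]: "B \<in> sets borel" using open_B by simp
  have leb: "set_integrable lebesgue B (\<lambda>x. F x * weight N a x)"
    using B_integral(1)[OF assms] unfolding \<omega>_eq .
  have m: "(\<lambda>x. indicator B x *\<^sub>R (F x * weight N a x)) \<in> borel_measurable lborel" by measurable
  show "set_integrable lborel B (\<lambda>x. F x * weight N a x)"
    using leb unfolding set_integrable_def integrable_completion[OF m] .
  show "(LBINT x:B. F x * weight N a x) = integral B (\<lambda>x. F x * \<omega> x)"
    unfolding \<omega>_eq set_lebesgue_integral_eq_integral(2)[OF leb, symmetric]
    unfolding set_lebesgue_integral_def integral_completion[OF m] ..
qed

text \<open>The square root of the double factor is \<open>\<bar>x - x0\<bar>\<close>, which cancels
  against the zero of \<open>p\<close>; that zero is simple by the sign condition in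
  \<open>at_y\<close>.\<close>

lemma (in periodic_jacobi) weight_tendsto_at_double_root:
  assumes p0: "poly p x0 = 0" and r: "\<And>x. (poly g x)\<^sup>2 - 1 = (x - x0)\<^sup>2 * r x" "isCont r x0"
  shows "\<exists>l. (weight N a \<longlongrightarrow> l) (at x0)"
proof -
  from p0 obtain s where s: "p = [:- x0, 1:] * s" by (auto simp: poly_eq_0_iff_dvd dvd_def)
  obtain k where k: "k \<in> {1..N - 1}" "x0 = y k" using p0 y_zeros by blast
  have "poly (pderiv p) x0 = poly s x0" unfolding s by (simp add: pderiv_mult pderiv_pCons del: mult_pCons_left)
  hence s0: "poly s x0 \<noteq> 0" using at_y(4)[OF k(1)] k(2) by auto
  have eq: "weight N a x = 2 * sqrt \<bar>r x\<bar> / (pi * \<bar>poly s x\<bar>)" if "x \<noteq> x0" for x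
  proof -
    have "\<bar>1 - (poly g x)\<^sup>2\<bar> = (x - x0)\<^sup>2 * \<bar>r x\<bar>"
      using r(1)[of x] by (simp add: abs_minus_commute[of 1] abs_mult)
    hence "sqrt \<bar>1 - (poly g x)\<^sup>2\<bar> = \<bar>x - x0\<bar> * sqrt \<bar>r x\<bar>" by (simp add: real_sqrt_mult)
    moreover have "poly p x = (x - x0) * poly s x" unfolding s by (simp add: algebra_simps)
    ultimately show ?thesis unfolding weight_def using that by (simp add: abs_mult)
  qed
  have "((\<lambda>x. 2 * sqrt \<bar>r x\<bar> / (pi * \<bar>poly s x\<bar>)) \<longlongrightarrow> 2 * sqrt \<bar>r x0\<bar> / (pi * \<bar>poly s x0\<bar>)) (at x0)"
    using s0 r(2) by (intro tendsto_intros) (auto simp: isCont_def)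
  hence "(weight N a \<longlongrightarrow> 2 * sqrt \<bar>r x0\<bar> / (pi * \<bar>poly s x0\<bar>)) (at x0)"
    by (rule Lim_transform_eventually) (auto simp: eventually_at_filter eq)
  thus ?thesis by blast
qed

theorem theorem6p2:
  fixes N :: nat and a :: real and \<xi> y :: "nat \<Rightarrow> real"
  assumes "N \<ge> 1"
    and "proots ((gN N a)\<^sup>2 - 1) = image_mset \<xi> (mset_set {1..2 * N})"
    and "\<forall>k\<in>{1..N}. \<xi> (2 * k - 1) < \<xi> (2 * k)"
    and "\<forall>k\<in>{1..<N}. \<xi> (2 * k) \<le> \<xi> (2 * k + 1)"
    and "y ` {1..N - 1} = {x. poly (PN N a (N - 1)) x = 0}"
    and "strict_mono_on {1..N - 1} y"
  shows "orthogonal_wrt (mu N a \<xi> y) (PN N a) \<and>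
    (\<forall>x\<in>bands N \<xi>. weight N a x > 0) \<and>
    set_integrable lborel (bands N \<xi>) (weight N a) \<and>
    (\<forall>k\<in>{1..<N}. \<xi> (2 * k) = \<xi> (2 * k + 1) \<longrightarrow>
      poly (PN N a (N - 1)) (\<xi> (2 * k)) = 0 \<and>
      (\<exists>l. (weight N a \<longlongrightarrow> l) (at (\<xi> (2 * k))))) \<and>
    (\<Sum>k=1..N. LBINT x:{\<xi> (2 * k - 1) <..< \<xi> (2 * k)}.
            2 * sqrt \<bar>1 - (poly (gN N a) x)\<^sup>2\<bar> / (pi * \<bar>poly (PN N a (N - 1)) x\<bar>))
       = 1 - (\<Sum>k | 1 \<le> k \<and> k \<le> N - 1 \<and> \<bar>poly (PN N a N) (y k)\<bar> < 1.
            4 * sqrt \<bar>(poly (gN N a) (y k))\<^sup>2 - 1\<bar> / \<bar>poly (pderiv (PN N a (N - 1))) (y k)\<bar>)"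
proof -
  interpret periodic_jacobi N a y using assms(1,5,6) by unfold_locales
  note bands = bands_eq[OF assms(1-4)]
  have B: "B = bands N \<xi>" unfolding B_def bands(1) ..
  have moment: "has_bochner_integral (mu N a \<xi> y) (\<lambda>x. poly (P m) x * poly (P n) x) (if m = n then 1 else 0)"
    for m n
  proof -
    have c: "continuous_on UNIV (\<lambda>x. poly (P m) x * poly (P n) x)" by (intro continuous_intros)
    have "L (\<lambda>x. poly (P m) x * poly (P n) x) = (if m = n then 1 else 0)"
      using L_P_P[of m n] by (simp add: poly_mult[abs_def])
    moreover have "has_bochner_integral (mu N a \<xi> y) (\<lambda>x. poly (P m) x * poly (P n) x)
        (L (\<lambda>x. poly (P m) x * poly (P n) x))"
      unfolding L_def B_lborel(2)[OF c, symmetric] unfolding B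
      using B_lborel(1)[OF c] unfolding B
      by (intro has_bochner_integral_mu borel_measurable_continuous_onI[OF c])
    ultimately show ?thesis by simp
  qed
  have "orthogonal_wrt (mu N a \<xi> y) (PN N a)"
    unfolding orthogonal_wrt_def using moment by (auto simp: has_bochner_integral_iff)
  moreover have "weight N a x > 0" if "x \<in> bands N \<xi>" for x
  proof -
    have g: "\<bar>poly g x\<bar> < 1" using that bands(1) by auto
    have "poly p x \<noteq> 0" using p_pderiv_g_pos_on_band[OF g] by auto
    moreover have "1 - (poly g x)\<^sup>2 > 0" using g by (simp add: abs_square_less_1)
    ultimately show ?thesis unfolding weight_def by (intro divide_pos_pos mult_pos_pos) auto
  qed
  moreover have w_int: "set_integrable lborel (bands N \<xi>) (weight N a)"
    using B_lborel(1)[of "\<lambda>_. 1"] unfolding B by simp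
  moreover have "poly p (\<xi> (2 * k)) = 0 \<and> (\<exists>l. (weight N a \<longlongrightarrow> l) (at (\<xi> (2 * k))))"
    if k: "k \<in> {1..<N}" and closed: "\<xi> (2 * k) = \<xi> (2 * k + 1)" for k
  proof -
    let ?x0 = "\<xi> (2 * k)"
    \<comment> \<open>\<open>R\<close> collects the pairs of the other bands. The two touching ends
      give the square \<open>(x - ?x0)^2\<close>, and \<open>r\<close> is the remaining cofactor of
      \<open>g^2 - 1\<close>.\<close>
    define R where "R = (\<lambda>x. \<Prod>i\<in>{1..N} - {k} - {k + 1}. (x - \<xi> (2 * i - 1)) * (x - \<xi> (2 * i)))"
    define r where "r = (\<lambda>x. 4 ^ (N - 1) * ((x - \<xi> (2 * k - 1)) * (x - \<xi> (2 * k + 2)) * R x))"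
    have r: "(poly g x)\<^sup>2 - 1 = (x - ?x0)\<^sup>2 * r x" for x
    proof -
      let ?f = "\<lambda>i. (x - \<xi> (2 * i - 1)) * (x - \<xi> (2 * i))"
      have "(\<Prod>i=1..N. ?f i) = ?f k * (?f (k + 1) * R x)"
        unfolding R_def using k by (subst prod.remove[of _ k], simp, simp, subst prod.remove[of _ "k + 1"]) auto
      also have "?f (k + 1) = (x - ?x0) * (x - \<xi> (2 * k + 2))" using closed by simp
      finally show ?thesis unfolding gN_sq_minus_1[OF assms(1,2)] r_def
        by (simp only: power2_eq_square mult_ac)
    qed
    have "isCont r ?x0" unfolding r_def R_def by (intro continuous_intros)
    \<comment> \<open>The distance to the outer ends of the two touching bands: within it every
      point other than \<open>?x0\<close> lies in a band.\<close>
    define e where "e = min (?x0 - \<xi> (2 * k - 1)) (\<xi> (2 * (k + 1)) - ?x0)"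
    have "\<xi> (2 * k - 1) < ?x0" "\<xi> (2 * (k + 1) - 1) < \<xi> (2 * (k + 1))"
      using k assms(3)[rule_format, of k] assms(3)[rule_format, of "k + 1"] by simp_all
    hence e: "e > 0" using closed by (simp add: e_def)
    have "\<bar>poly g x\<bar> < 1" if x: "x \<noteq> ?x0" "\<bar>x - ?x0\<bar> < e" for x
    proof -
      have "x \<in> bands N \<xi>"
      proof (cases "x < ?x0")
        case True
        thus ?thesis unfolding bands_def using x k by (intro UN_I[of k]) (auto simp: e_def)
      next
        case False
        thus ?thesis unfolding bands_def using x k closed by (intro UN_I[of "k + 1"]) (auto simp: e_def)
      qed
      thus ?thesis using bands(1) by auto
    qed
    moreover have "\<bar>poly g ?x0\<bar> = 1" using r[of ?x0] by (simp add: abs_square_eq_1)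
    ultimately have "poly p ?x0 = 0" using e by (intro p_zero_at_closed_gap)
    thus ?thesis using weight_tendsto_at_double_root[OF _ r \<open>isCont r ?x0\<close>] by blast
  qed
  moreover have "(\<Sum>k=1..N. LBINT x:{\<xi> (2 * k - 1) <..< \<xi> (2 * k)}. weight N a x)
      = 1 - (\<Sum>k | 1 \<le> k \<and> k \<le> N - 1 \<and> \<bar>poly (PN N a N) (y k)\<bar> < 1.
            4 * sqrt \<bar>(poly (gN N a) (y k))\<^sup>2 - 1\<bar> / \<bar>poly (pderiv (PN N a (N - 1))) (y k)\<bar>)"
  proof -
    have "(LBINT x:bands N \<xi>. weight N a x) = (\<Sum>k=1..N. LBINT x:{\<xi> (2 * k - 1) <..< \<xi> (2 * k)}. weight N a x)"
      unfolding bands_def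
    proof (rule set_integral_finite_Union)
      show "disjoint_family_on (\<lambda>k. {\<xi> (2 * k - 1)<..<\<xi> (2 * k)}) {1..N}"
      proof (unfold disjoint_family_on_def, intro ballI impI)
        fix i j assume "i \<in> {1..N}" "j \<in> {1..N}" "i \<noteq> j"
        thus "{\<xi> (2 * i - 1)<..<\<xi> (2 * i)} \<inter> {\<xi> (2 * j - 1)<..<\<xi> (2 * j)} = {}"
          using bands(2)[of i j] bands(2)[of j i] by (cases "i < j") auto
      qed
      show "set_integrable lborel {\<xi> (2 * k - 1)<..<\<xi> (2 * k)} (weight N a)" if "k \<in> {1..N}" for k
        using that by (intro set_integrable_subset[OF w_int]) (auto simp: bands_def)
    qed auto
    moreover have "(LBINT x:bands N \<xi>. weight N a x) = integral B (\<lambda>x. 1 * \<omega> x)"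
      using B_lborel(2)[of "\<lambda>_. 1"] unfolding B by simp
    \<comment> \<open>The total mass is the zeroth moment, since \<open>P_0 = 1\<close>.\<close>
    moreover have "integral B (\<lambda>x. 1 * \<omega> x) + (\<Sum>k=1..N - 1. mass N a (y k) * 1) = 1"
      using L_P[of 0] by (simp add: L_def)
    moreover have "(\<Sum>k=1..N - 1. mass N a (y k) * 1)
        = (\<Sum>k | 1 \<le> k \<and> k \<le> N - 1 \<and> \<bar>poly (PN N a N) (y k)\<bar> < 1.
            4 * sqrt \<bar>(poly (gN N a) (y k))\<^sup>2 - 1\<bar> / \<bar>poly (pderiv (PN N a (N - 1))) (y k)\<bar>)"
      by (rule sum.mono_neutral_cong_right) (auto simp: mass_def)
    ultimately show ?thesis by linarith
  qed
  ultimately show ?thesis unfolding weight_def by blast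
qed

end
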